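(* There exists a universal constant $C>0$ such that the following holds. Let $n,d\ge1$, $\delta\in(0,1)$ and $\sigma=C\sqrt{\log(20n/\delta)}$. There is a randomized algorithm $h:(\mathbb{R}^d\times\mathbb{R})^n\to(\mathbb{R}^d\times\mathbb{R})^n$, running in time polynomial in $n$ and $\log(1/\delta)$, such that for every fixed choice of signs $R_1,\dots,R_n\in\{-1,1\}$, every $\beta_\star\in\mathbb{R}^d$, and all $x_1,\dots,x_n\in\mathbb{R}^d$ (on which we condition) with $\max_{i}|\langle x_i,\beta_\star\rangle|\le1/2$, if $$y_i=R_i\langle x_i,\beta_\star\rangle+\xi_i,\qquad\xi_1,\dots,\xi_n\overset{i.i.d.}{\sim}\mathsf{Unif}([-1/2,1/2]),$$ and $$\widetilde y_i=|\langle x_i,\beta_\star\rangle|+\sigma\varepsilon_i,\qquad\varepsilon_1,\dots,\varepsilon_n\overset{i.i.d.}{\sim}\mathcal{N}(0,1),$$ then $$\mathsf{d_{TV}}\Big(h\big((x_i,y_i)_{i=1}^n\big),\,(x_i,\widetilde y_i)_{i=1}^n\Big)\le\delta.$$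
   Context: $\mathsf{d_{TV}}(A,B)$ is the total variation distance between the laws of the random variables $A$ and $B$. A randomized algorithm is a Markov kernel (its internal randomness is independent of the data); it does not have access to $\beta_\star$ or to $(R_i)$. Running time is in a real-arithmetic model in which sampling from a uniform or Gaussian distribution, evaluating elementary functions such as $\exp$ at a real number, and copying a covariate vector $x_i$ to the output have unit cost. *)

theory Defs
  imports "HOL-Probability.Probability"
begin

section \<open>Vectors, samples and total variation distance\<close>

text \<open>
  The dimension \<open>d\<close> is a number rather than a type, so that constants and programs can be
  chosen before \<open>d\<close>. Indices start at 0: a vector in dimension \<open>d\<close> is a point of
  \<open>space (Rd d)\<close>, i.e. a function on \<open>nat\<close> that is \<open>undefined\<close> outside \<open>{..<d}\<close>, and a data set
  is such a function from \<open>{..<n}\<close> to pairs.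
\<close>

type_synonym vec = "nat \<Rightarrow> real"
type_synonym dataset = "nat \<Rightarrow> vec \<times> real"

definition Rd :: "nat \<Rightarrow> vec measure" where
  "Rd d = PiM {..<d} (\<lambda>_. borel)"

definition data_space :: "nat \<Rightarrow> nat \<Rightarrow> dataset measure" where
  "data_space n d = PiM {..<n} (\<lambda>_. Rd d \<Otimes>\<^sub>M borel)"

definition dotp :: "nat \<Rightarrow> vec \<Rightarrow> vec \<Rightarrow> real" where
  "dotp d u v = (\<Sum>j<d. u j * v j)"

text \<open>Meant for two probability measures on the same sigma-algebra.\<close>

definition tv_dist :: "'a measure \<Rightarrow> 'a measure \<Rightarrow> real" where
  "tv_dist M N = (SUP A\<in>sets M. \<bar>measure M A - measure N A\<bar>)"

definition std_gaussian :: "real measure" where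
  "std_gaussian = density lborel (\<lambda>t. ennreal (normal_density 0 1 t))"

section \<open>Randomized real-arithmetic programs\<close>

text \<open>
  Programs are written in a structured real-RAM language. The store consists of finitely many
  natural-number registers (for addresses and loop counters) and a random-access real memory. The
  only operations on natural numbers are addition and truncated subtraction, and there is no
  rounding from reals to natural numbers, so that unit-cost arithmetic cannot be abused. Constants
  in programs are natural numbers or integers. The input is read only.
\<close>

datatype iexp = IConst nat | IReg nat | IAdd iexp iexp | ISub iexp iexp

datatype rexp =
    RConst int
  | RMem iexp                     \<comment> \<open>real memory cell at a computed address\<close>
  | ROfNat iexp
  | Covariate iexp iexp           \<comment> \<open>coordinate \<open>j\<close> of the input vector \<open>x\<^sub>i\<close>\<close>
  | Response iexp                 \<comment> \<open>the input number \<open>y\<^sub>i\<close>\<close>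
  | RAdd rexp rexp | RSub rexp rexp | RMul rexp rexp | RDiv rexp rexp
  | RExp rexp | RLn rexp | RSqrt rexp

datatype bexp =
    ILess iexp iexp
  | RLess rexp rexp
  | BNot bexp
  | BAnd bexp bexp

datatype com =
    Skip
  | SetReg nat iexp
  | SetMem iexp rexp
  | DrawUniform iexp              \<comment> \<open>store a fresh sample from \<open>Unif([0,1])\<close>\<close>
  | DrawGaussian iexp             \<comment> \<open>store a fresh sample from \<open>N(0,1)\<close>\<close>
  | CopyCovariate iexp iexp       \<comment> \<open>\<open>CopyCovariate k i\<close>: the \<open>k\<close>-th output vector becomes \<open>x\<^sub>i\<close>\<close>
  | WriteCoord iexp iexp rexp
  | WriteResponse iexp rexp
  | Seq com com
  | Cond bexp com com
  | Loop bexp com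

text \<open>
  The internal randomness is supplied by two infinite tapes of i.i.d. samples; each draw
  consumes the next entry of its tape, whose position is kept in the state.
\<close>

record input =
  in_x :: "nat \<Rightarrow> vec"
  in_y :: "nat \<Rightarrow> real"
  unif_tape :: "nat \<Rightarrow> real"
  gauss_tape :: "nat \<Rightarrow> real"

record state =
  regs :: "nat \<Rightarrow> nat"
  memory :: "nat \<Rightarrow> real"
  unif_pos :: nat
  gauss_pos :: nat
  out_x :: "nat \<Rightarrow> vec"
  out_y :: "nat \<Rightarrow> real"

primrec ival :: "state \<Rightarrow> iexp \<Rightarrow> nat" where
  "ival s (IConst k) = k"
| "ival s (IReg r) = regs s r"
| "ival s (IAdd a b) = ival s a + ival s b"
| "ival s (ISub a b) = ival s a - ival s b"

primrec rval :: "input \<Rightarrow> state \<Rightarrow> rexp \<Rightarrow> real" where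
  "rval e s (RConst c) = of_int c"
| "rval e s (RMem a) = memory s (ival s a)"
| "rval e s (ROfNat a) = real (ival s a)"
| "rval e s (Covariate i j) = in_x e (ival s i) (ival s j)"
| "rval e s (Response i) = in_y e (ival s i)"
| "rval e s (RAdd a b) = rval e s a + rval e s b"
| "rval e s (RSub a b) = rval e s a - rval e s b"
| "rval e s (RMul a b) = rval e s a * rval e s b"
| "rval e s (RDiv a b) = rval e s a / rval e s b"
| "rval e s (RExp a) = exp (rval e s a)"
| "rval e s (RLn a) = ln (rval e s a)"
| "rval e s (RSqrt a) = sqrt (rval e s a)"

primrec bval :: "input \<Rightarrow> state \<Rightarrow> bexp \<Rightarrow> bool" where
  "bval e s (ILess a b) \<longleftrightarrow> ival s a < ival s b"
| "bval e s (RLess a b) \<longleftrightarrow> rval e s a < rval e s b"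
| "bval e s (BNot b) \<longleftrightarrow> \<not> bval e s b"
| "bval e s (BAnd a b) \<longleftrightarrow> bval e s a \<and> bval e s b"

text \<open>Every constant, access, operation and comparison costs one time unit.\<close>

primrec icost :: "iexp \<Rightarrow> nat" where
  "icost (IConst k) = 1"
| "icost (IReg r) = 1"
| "icost (IAdd a b) = 1 + icost a + icost b"
| "icost (ISub a b) = 1 + icost a + icost b"

primrec rcost :: "rexp \<Rightarrow> nat" where
  "rcost (RConst c) = 1"
| "rcost (RMem a) = 1 + icost a"
| "rcost (ROfNat a) = 1 + icost a"
| "rcost (Covariate i j) = 1 + icost i + icost j"
| "rcost (Response i) = 1 + icost i"
| "rcost (RAdd a b) = 1 + rcost a + rcost b"
| "rcost (RSub a b) = 1 + rcost a + rcost b"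
| "rcost (RMul a b) = 1 + rcost a + rcost b"
| "rcost (RDiv a b) = 1 + rcost a + rcost b"
| "rcost (RExp a) = 1 + rcost a"
| "rcost (RLn a) = 1 + rcost a"
| "rcost (RSqrt a) = 1 + rcost a"

primrec bcost :: "bexp \<Rightarrow> nat" where
  "bcost (ILess a b) = 1 + icost a + icost b"
| "bcost (RLess a b) = 1 + rcost a + rcost b"
| "bcost (BNot b) = 1 + bcost b"
| "bcost (BAnd a b) = 1 + bcost a + bcost b"

text \<open>
  \<open>exec e c s t s'\<close>: on input and tapes \<open>e\<close>, the program \<open>c\<close> started in state \<open>s\<close> halts in state \<open>s'\<close>
  after \<open>t\<close> time units.
\<close>

inductive exec :: "input \<Rightarrow> com \<Rightarrow> state \<Rightarrow> nat \<Rightarrow> state \<Rightarrow> bool" for e :: input where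
  Skip: "exec e Skip s 1 s"
| SetReg: "exec e (SetReg r a) s (1 + icost a) (s\<lparr>regs := (regs s)(r := ival s a)\<rparr>)"
| SetMem: "exec e (SetMem a b) s (1 + icost a + rcost b)
    (s\<lparr>memory := (memory s)(ival s a := rval e s b)\<rparr>)"
| DrawUniform: "exec e (DrawUniform a) s (1 + icost a)
    (s\<lparr>memory := (memory s)(ival s a := unif_tape e (unif_pos s)), unif_pos := Suc (unif_pos s)\<rparr>)"
| DrawGaussian: "exec e (DrawGaussian a) s (1 + icost a)
    (s\<lparr>memory := (memory s)(ival s a := gauss_tape e (gauss_pos s)), gauss_pos := Suc (gauss_pos s)\<rparr>)"
| CopyCovariate: "exec e (CopyCovariate k i) s (1 + icost k + icost i)
    (s\<lparr>out_x := (out_x s)(ival s k := in_x e (ival s i))\<rparr>)"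
| WriteCoord: "exec e (WriteCoord k j b) s (1 + icost k + icost j + rcost b)
    (s\<lparr>out_x := (out_x s)(ival s k := (out_x s (ival s k))(ival s j := rval e s b))\<rparr>)"
| WriteResponse: "exec e (WriteResponse k b) s (1 + icost k + rcost b)
    (s\<lparr>out_y := (out_y s)(ival s k := rval e s b)\<rparr>)"
| Seq: "exec e c1 s t1 s1 \<Longrightarrow> exec e c2 s1 t2 s2 \<Longrightarrow> exec e (Seq c1 c2) s (t1 + t2) s2"
| CondTrue: "bval e s b \<Longrightarrow> exec e c1 s t s' \<Longrightarrow> exec e (Cond b c1 c2) s (1 + bcost b + t) s'"
| CondFalse: "\<not> bval e s b \<Longrightarrow> exec e c2 s t s' \<Longrightarrow> exec e (Cond b c1 c2) s (1 + bcost b + t) s'"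
| LoopFalse: "\<not> bval e s b \<Longrightarrow> exec e (Loop b c) s (1 + bcost b) s"
| LoopTrue: "bval e s b \<Longrightarrow> exec e c s t1 s1 \<Longrightarrow> exec e (Loop b c) s1 t2 s2 \<Longrightarrow>
    exec e (Loop b c) s (1 + bcost b + t1 + t2) s2"

inductive_cases exec_SkipE: "exec e Skip s t s'"
inductive_cases exec_SetRegE: "exec e (SetReg r a) s t s'"
inductive_cases exec_SetMemE: "exec e (SetMem a b) s t s'"
inductive_cases exec_DrawUniformE: "exec e (DrawUniform a) s t s'"
inductive_cases exec_DrawGaussianE: "exec e (DrawGaussian a) s t s'"
inductive_cases exec_CopyCovariateE: "exec e (CopyCovariate k i) s t s'"
inductive_cases exec_WriteCoordE: "exec e (WriteCoord k j b) s t s'"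
inductive_cases exec_WriteResponseE: "exec e (WriteResponse k b) s t s'"
inductive_cases exec_SeqE: "exec e (Seq c1 c2) s t s'"
inductive_cases exec_CondE: "exec e (Cond b c1 c2) s t s'"
inductive_cases exec_LoopE: "exec e (Loop b c) s t s'"

lemma exec_deterministic:
  "exec e c s t s' \<Longrightarrow> exec e c s u s'' \<Longrightarrow> u = t \<and> s'' = s'"
proof (induction arbitrary: u s'' rule: exec.induct)
  case (Seq c1 s t1 s1 c2 t2 s2)
  from Seq.prems show ?case by (rule exec_SeqE) (metis Seq.IH)
next
  case (CondTrue s b c1 t s' c2)
  from CondTrue.prems show ?case by (rule exec_CondE) (auto simp: CondTrue.hyps dest: CondTrue.IH)
next
  case (CondFalse s b c2 t s' c1)
  from CondFalse.prems show ?case by (rule exec_CondE) (auto simp: CondFalse.hyps dest: CondFalse.IH)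
next
  case (LoopFalse s b c)
  from LoopFalse.prems show ?case by (rule exec_LoopE) (simp_all add: LoopFalse.hyps)
next
  case (LoopTrue s b c t1 s1 t2 s2)
  from LoopTrue.prems show ?case by (rule exec_LoopE) (use LoopTrue.hyps(1) in \<open>auto dest!: LoopTrue.IH\<close>)
qed (erule exec_SkipE exec_SetRegE exec_SetMemE exec_DrawUniformE exec_DrawGaussianE
      exec_CopyCovariateE exec_WriteCoordE exec_WriteResponseE, simp)+

text \<open>Reads outside the ranges \<open>i < n\<close> and \<open>j < d\<close> return 0.\<close>

definition make_input ::
  "nat \<Rightarrow> nat \<Rightarrow> dataset \<Rightarrow> (nat \<Rightarrow> real) \<times> (nat \<Rightarrow> real) \<Rightarrow> input" where
  "make_input n d D \<omega> =
     \<lparr>in_x = (\<lambda>i j. if i < n \<and> j < d then fst (D i) j else 0),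
      in_y = (\<lambda>i. if i < n then snd (D i) else 0),
      unif_tape = fst \<omega>, gauss_tape = snd \<omega>\<rparr>"

text \<open>The parameters are passed to the program in register 0, register 1 and memory cell 0.\<close>

definition init_state :: "nat \<Rightarrow> nat \<Rightarrow> real \<Rightarrow> state" where
  "init_state n d \<delta> =
     \<lparr>regs = (\<lambda>_. 0)(0 := n, 1 := d), memory = (\<lambda>_. 0)(0 := \<delta>),
      unif_pos = 0, gauss_pos = 0, out_x = (\<lambda>_ _. 0), out_y = (\<lambda>_. 0)\<rparr>"

definition final_output :: "nat \<Rightarrow> nat \<Rightarrow> state \<Rightarrow> dataset" where
  "final_output n d s = (\<lambda>i\<in>{..<n}. (\<lambda>j\<in>{..<d}. out_x s i j, out_y s i))"

definition random_tapes :: "((nat \<Rightarrow> real) \<times> (nat \<Rightarrow> real)) measure" where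
  "random_tapes =
     PiM UNIV (\<lambda>_. uniform_measure lborel {0..1}) \<Otimes>\<^sub>M PiM UNIV (\<lambda>_. std_gaussian)"

text \<open>
  The program \<open>P\<close>, run with parameters \<open>n\<close>, \<open>d\<close>, \<open>\<delta>\<close>, halts within \<open>T\<close> time units on every data set
  and for every outcome of the internal randomness, and its random output on the data set \<open>D\<close> has
  law \<open>h D\<close>. Here \<open>f D \<omega>\<close> is the output on tapes \<open>\<omega>\<close>; it is unique by \<open>exec_deterministic\<close>.
\<close>

definition computes_kernel ::
  "com \<Rightarrow> nat \<Rightarrow> nat \<Rightarrow> real \<Rightarrow> real \<Rightarrow> (dataset \<Rightarrow> dataset measure) \<Rightarrow> bool" where
  "computes_kernel P n d \<delta> T h \<longleftrightarrow>
     (\<exists>f. \<forall>D \<in> space (data_space n d).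
        (\<forall>\<omega> \<in> space random_tapes. \<exists>t s.
           exec (make_input n d D \<omega>) P (init_state n d \<delta>) t s \<and>
           real t \<le> T \<and> final_output n d s = f D \<omega>) \<and>
        f D \<in> random_tapes \<rightarrow>\<^sub>M data_space n d \<and>
        h D = distr random_tapes (data_space n d) (f D))"

section \<open>The two regression models\<close>

text \<open>
  Laws of \<open>(x\<^sub>i, y\<^sub>i)\<close> with \<open>y\<^sub>i = R\<^sub>i \<langle>x\<^sub>i, \<beta>\<rangle> + \<xi>\<^sub>i\<close>, and of \<open>(x\<^sub>i, y\<^sub>i)\<close> with
  \<open>y\<^sub>i = \<bar>\<langle>x\<^sub>i, \<beta>\<rangle>\<bar> + \<sigma> \<epsilon>\<^sub>i\<close>; only the noise is random.
\<close>

definition signed_model ::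
  "nat \<Rightarrow> nat \<Rightarrow> (nat \<Rightarrow> real) \<Rightarrow> vec \<Rightarrow> (nat \<Rightarrow> vec) \<Rightarrow> dataset measure" where
  "signed_model n d R \<beta> x =
     distr (PiM {..<n} (\<lambda>_. uniform_measure lborel {-1/2..1/2})) (data_space n d)
       (\<lambda>\<xi>. \<lambda>i\<in>{..<n}. (x i, R i * dotp d (x i) \<beta> + \<xi> i))"

definition abs_model ::
  "nat \<Rightarrow> nat \<Rightarrow> real \<Rightarrow> vec \<Rightarrow> (nat \<Rightarrow> vec) \<Rightarrow> dataset measure" where
  "abs_model n d \<sigma> \<beta> x =
     distr (PiM {..<n} (\<lambda>_. std_gaussian)) (data_space n d)
       (\<lambda>\<epsilon>. \<lambda>i\<in>{..<n}. (x i, \<bar>dotp d (x i) \<beta>\<bar> + \<sigma> * \<epsilon> i))"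

end

(*
Let tau = R_i <x_i, beta>, so that y is uniform on [tau - 1/2, tau + 1/2].  Both ends of this interval
satisfy center y = |tau|, where center y = | |y| - 1/2 |.  Let
F y z = (y + 1/2) * phi (z - center y), with phi the density of N(0, sigma^2).  Its y-derivative is
phi (z - center y) * (1 + tilt y * (z - center y) / sigma^2), and the increment of F over
[tau - 1/2, tau + 1/2] is exactly phi (z - |tau|).  Hence sampling z from that derivative turns the
signed model into the absolute one, except that the derivative may be negative for |z| of order
sigma^2.  Clipping the tilt to [-1, 1] makes it a probability density, which is sampled exactly by
drawing w ~ N(0, 1), flipping its sign with probability (1 - clip (tilt y * w / sigma)) / 2, and
returning center y + sigma * w.  By the Gaussian tail the clipping costs sqrt 2 * exp (- sigma^2 / 9)
in total variation, and C = 3 makes n times this error at most delta.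
*)
theory Submission
  imports Defs
begin

section \<open>Resampling one response\<close>

definition center :: "real \<Rightarrow> real" where
  "center y = \<bar>\<bar>y\<bar> - 1/2\<bar>"

text \<open>This is \<open>y + 1/2\<close> times the slope of \<open>center\<close>. At the kinks
  -1/2, 0 and 1/2 the convention \<open>sgn 0 = 0\<close> fixes the value on a null set.\<close>

definition tilt :: "real \<Rightarrow> real" where
  "tilt y = (y + 1/2) * (sgn (\<bar>y\<bar> - 1/2) * sgn y)"

definition clip :: "real \<Rightarrow> real" where
  "clip t = max (-1) (min 1 t)"

lemma center_measurable [measurable]: "center \<in> borel_measurable borel"
  unfolding center_def by measurable

lemma tilt_measurable [measurable]: "tilt \<in> borel_measurable borel"
  unfolding tilt_def by measurable

lemma clip_measurable [measurable]: "clip \<in> borel_measurable borel"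
  unfolding clip_def by measurable

text \<open>A response satisfies \<open>\<bar>y\<bar> \<le> 1\<close>, because both
  \<open>\<tau>\<close> and the uniform noise are at most 1/2 in absolute value. The constant 3/2 is
  the source of the 9 in the error exponent.\<close>

lemma abs_tilt_le: "\<bar>y\<bar> \<le> 1 \<Longrightarrow> \<bar>tilt y\<bar> \<le> 3/2"
  by (auto simp: tilt_def abs_mult sgn_if)

lemma clip_minus: "clip (- t) = - clip t"
  by (auto simp: clip_def max_def min_def)

lemma clip_bounds: "-1 \<le> clip t" "clip t \<le> 1"
  by (auto simp: clip_def)

section \<open>The signed kernel as a derivative in the response\<close>

lemma has_real_derivative_abs:
  fixes x :: real
  assumes "x \<noteq> 0"
  shows "(abs has_real_derivative sgn x) (at x)"
proof (cases "x > 0")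
  case True
  have "((\<lambda>x. x) has_real_derivative sgn x) (at x)"
    using True by (auto intro!: derivative_eq_intros)
  then show ?thesis
    by (rule has_field_derivative_transform_within_open[of _ _ _ "{0<..}"]) (use True in auto)
next
  case False
  then have "x < 0" using assms by simp
  then have "((\<lambda>x. - x) has_real_derivative sgn x) (at x)"
    by (auto intro!: derivative_eq_intros)
  then show ?thesis
    by (rule has_field_derivative_transform_within_open[of _ _ _ "{..<0}"]) (use \<open>x < 0\<close> in auto)
qed

lemma center_has_derivative:
  assumes "y \<notin> {-1/2, 0, 1/2}"
  shows "(center has_real_derivative sgn (\<bar>y\<bar> - 1/2) * sgn y) (at y)"
proof -
  have "\<bar>y\<bar> - 1/2 \<noteq> 0" "y \<noteq> 0" using assms by auto
  have "((\<lambda>y. \<bar>y\<bar> - 1/2) has_real_derivative sgn y - 0) (at y)"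
    by (intro DERIV_diff has_real_derivative_abs DERIV_const) fact
  from DERIV_chain2[OF has_real_derivative_abs[OF \<open>\<bar>y\<bar> - 1/2 \<noteq> 0\<close>] this]
  show ?thesis by (simp add: center_def[abs_def])
qed

lemma normal_density_mean_has_derivative:
  assumes "\<sigma> > 0"
  shows "((\<lambda>m. normal_density m \<sigma> z) has_real_derivative normal_density m \<sigma> z * ((z - m) / \<sigma>\<^sup>2)) (at m)"
proof -
  have "((\<lambda>m. - (z - m)\<^sup>2 / (2 * \<sigma>\<^sup>2)) has_real_derivative (z - m) / \<sigma>\<^sup>2) (at m)"
    using assms by (auto intro!: derivative_eq_intros simp: field_simps)
  from DERIV_cmult[OF DERIV_fun_exp[OF this], of "1 / sqrt (2 * pi * \<sigma>\<^sup>2)"]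
  show ?thesis by (simp add: normal_density_def)
qed

lemma normal_density_center_has_derivative:
  assumes "\<sigma> > 0" "y \<notin> {-1/2, 0, 1/2}"
  shows "((\<lambda>y. (y + 1/2) * normal_density (center y) \<sigma> z) has_real_derivative
    normal_density (center y) \<sigma> z * (1 + tilt y * (z - center y) / \<sigma>\<^sup>2)) (at y)"
proof -
  have "((\<lambda>y. y + 1/2) has_real_derivative 1) (at y)"
    by (auto intro!: derivative_eq_intros)
  note DERIV_mult[OF this DERIV_chain2[OF normal_density_mean_has_derivative[OF assms(1)]
        center_has_derivative[OF assms(2)]], of z]
  then show ?thesis
    by (rule DERIV_cong) (simp only: tilt_def distrib_left mult_1_right mult_1 mult_ac times_divide_eq_left times_divide_eq_right)
qed

text \<open>The fundamental theorem of calculus applies because the antiderivative is continuous and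
  differentiable off three points. Its two boundary values carry the same Gaussian factor with
  weights \<open>\<tau> + 1\<close> and \<open>\<tau>\<close>, which differ by 1.\<close>

lemma tilted_density_has_integral:
  assumes "\<sigma> > 0" "\<bar>\<tau>\<bar> \<le> 1/2"
  shows "((\<lambda>y. normal_density (center y) \<sigma> z * (1 + tilt y * (z - center y) / \<sigma>\<^sup>2))
    has_integral normal_density \<bar>\<tau>\<bar> \<sigma> z) {\<tau> - 1/2..\<tau> + 1/2}"
proof -
  let ?F = "\<lambda>y. (y + 1/2) * normal_density (center y) \<sigma> z"
  have "continuous_on {\<tau> - 1/2..\<tau> + 1/2} ?F"
    unfolding normal_density_def center_def using assms(1) by (intro continuous_intros) auto
  moreover have "(?F has_vector_derivative
      normal_density (center y) \<sigma> z * (1 + tilt y * (z - center y) / \<sigma>\<^sup>2)) (at y)"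
    if "y \<in> {\<tau> - 1/2<..<\<tau> + 1/2} - {-1/2, 0, 1/2}" for y
    using normal_density_center_has_derivative[OF assms(1)] that
    unfolding has_real_derivative_iff_has_vector_derivative[symmetric] by blast
  ultimately have "((\<lambda>y. normal_density (center y) \<sigma> z * (1 + tilt y * (z - center y) / \<sigma>\<^sup>2))
      has_integral ?F (\<tau> + 1/2) - ?F (\<tau> - 1/2)) {\<tau> - 1/2..\<tau> + 1/2}"
    by (intro fundamental_theorem_of_calculus_interior_strong[of "{-1/2, 0, 1/2}"]) simp_all
  \<comment> \<open>Since \<open>\<bar>\<tau>\<bar> \<le> 1/2\<close>, the left end of the interval
    is at most 0 and the right end at least 0, so the inner absolute value resolves at each
    end.\<close>
  moreover have "center (\<tau> + 1/2) = \<bar>\<tau>\<bar>" "center (\<tau> - 1/2) = \<bar>\<tau>\<bar>"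
    using assms(2) by (auto simp: center_def)
  then have "?F (\<tau> + 1/2) - ?F (\<tau> - 1/2) = normal_density \<bar>\<tau>\<bar> \<sigma> z"
    by (simp add: distrib_right)
  ultimately show ?thesis by simp
qed

section \<open>Cost of clipping the tilt\<close>

text \<open>Clipping raises the weight only where the tilt term is below -1, hence only for
  \<open>\<bar>z - m\<bar>\<close> above \<open>2/3 * \<sigma>\<^sup>2\<close>. Half of the Gaussian
  exponent absorbs the excess there; the other half remains as a Gaussian of variance
  \<open>2 * \<sigma>\<^sup>2\<close>, whose normalization produces the factor
  \<open>sqrt 2\<close>.\<close>

lemma clip_error:
  assumes "\<sigma>\<^sup>2 \<ge> 9" "\<sigma> > 0" "\<bar>k\<bar> \<le> 3/2"
  shows "normal_density m \<sigma> z * (1 + clip (k * (z - m) / \<sigma>\<^sup>2)) \<le>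
    normal_density m \<sigma> z * (1 + k * (z - m) / \<sigma>\<^sup>2)
      + sqrt 2 * exp (- \<sigma>\<^sup>2 / 9) * normal_density m (sqrt 2 * \<sigma>) z"
proof -
  define t where "t = k * (z - m) / \<sigma>\<^sup>2"
  \<comment> \<open>This is the largest value of \<open>\<bar>t\<bar>\<close> that
    \<open>\<bar>k\<bar> \<le> 3/2\<close> allows. In terms of \<open>r\<close> the absorbed half of
    the exponent is \<open>\<sigma>\<^sup>2 / 9 * r\<^sup>2\<close>.\<close>
  define r where "r = 3/2 * \<bar>z - m\<bar> / \<sigma>\<^sup>2"
  have "\<bar>t\<bar> \<le> r"
    using mult_right_mono[OF assms(3), of "\<bar>z - m\<bar> / \<sigma>\<^sup>2"]
    by (simp add: t_def r_def abs_mult)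
  have "- (z - m)\<^sup>2 / (2 * \<sigma>\<^sup>2)
      = - (z - m)\<^sup>2 / (4 * \<sigma>\<^sup>2) + - (z - m)\<^sup>2 / (2 * (sqrt 2 * \<sigma>)\<^sup>2)"
    using assms(2) by (simp add: power_mult_distrib divide_simps)
  moreover have "1 / sqrt (2 * pi * \<sigma>\<^sup>2) = sqrt 2 * (1 / sqrt (2 * pi * (sqrt 2 * \<sigma>)\<^sup>2))"
  proof -
    have "2 * pi * (sqrt 2 * \<sigma>)\<^sup>2 = 2 * (2 * pi * \<sigma>\<^sup>2)" by (simp add: power_mult_distrib)
    then show ?thesis by (simp only: real_sqrt_mult[of 2 "2 * pi * \<sigma>\<^sup>2"]) simp
  qed
  ultimately have split: "normal_density m \<sigma> z
      = sqrt 2 * exp (- (z - m)\<^sup>2 / (4 * \<sigma>\<^sup>2)) * normal_density m (sqrt 2 * \<sigma>) z"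
    unfolding normal_density_def by (simp only: exp_add mult_ac)
  have q: "(z - m)\<^sup>2 / (4 * \<sigma>\<^sup>2) = \<sigma>\<^sup>2 / 9 * r\<^sup>2"
    using assms(2) by (simp add: r_def field_simps power2_eq_square)
  have "(clip t - t) * exp (- (\<sigma>\<^sup>2 / 9 * r\<^sup>2)) \<le> exp (- \<sigma>\<^sup>2 / 9)"
  proof (cases "\<bar>t\<bar> \<le> 1")
    case True
    then have "clip t = t" by (auto simp: clip_def max_def min_def)
    then show ?thesis by simp
  next
    case False
    then have r: "r \<ge> 1" using \<open>\<bar>t\<bar> \<le> r\<close> by simp
    have "r\<^sup>2 \<ge> r" using r by (simp add: power2_eq_square)
    have "clip t - t \<le> r - 1"
      using \<open>\<bar>t\<bar> \<le> r\<close> r by (auto simp: clip_def max_def min_def)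
    \<comment> \<open>The bound is loosened to the shape \<open>1 + s * (r\<^sup>2 - 1)\<close> with
      \<open>s = 1\<close>. Then \<open>\<sigma>\<^sup>2 \<ge> 9\<close> allows \<open>s\<close> to
      grow to \<open>\<sigma>\<^sup>2 / 9\<close>, and \<open>1 + v \<le> exp v\<close>
      applies.\<close>
    also have "r - 1 \<le> 1 + 1 * (r\<^sup>2 - 1)" using \<open>r\<^sup>2 \<ge> r\<close> by simp
    also have "\<dots> \<le> 1 + \<sigma>\<^sup>2 / 9 * (r\<^sup>2 - 1)"
      using assms(1) \<open>r\<^sup>2 \<ge> r\<close> r by (intro add_left_mono mult_right_mono) auto
    also have "\<dots> \<le> exp (\<sigma>\<^sup>2 / 9 * (r\<^sup>2 - 1))" by (rule exp_ge_add_one_self)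
    finally have "(clip t - t) * exp (- (\<sigma>\<^sup>2 / 9 * r\<^sup>2))
        \<le> exp (\<sigma>\<^sup>2 / 9 * (r\<^sup>2 - 1)) * exp (- (\<sigma>\<^sup>2 / 9 * r\<^sup>2))"
      by (rule mult_right_mono) simp
    also have "\<dots> = exp (- \<sigma>\<^sup>2 / 9)"
      by (simp add: field_simps flip: exp_add)
    finally show ?thesis .
  qed
  then have "(clip t - t) * exp (- (\<sigma>\<^sup>2 / 9 * r\<^sup>2)) * (sqrt 2 * normal_density m (sqrt 2 * \<sigma>) z)
      \<le> exp (- \<sigma>\<^sup>2 / 9) * (sqrt 2 * normal_density m (sqrt 2 * \<sigma>) z)"
    by (rule mult_right_mono) simp
  then have "normal_density m \<sigma> z * (clip t - t)
      \<le> sqrt 2 * exp (- \<sigma>\<^sup>2 / 9) * normal_density m (sqrt 2 * \<sigma>) z"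
    unfolding split q minus_divide_left[symmetric] by (simp only: mult_ac)
  then show ?thesis by (simp add: algebra_simps t_def)
qed

text \<open>\<open>clip_error\<close> is integrated over the responses: the unclipped kernels add up
  to the target density by the exact identity, and only the wide Gaussians remain as error.\<close>

lemma clipped_mixture_le:
  assumes \<sigma>: "\<sigma>\<^sup>2 \<ge> 9" "\<sigma> > 0" and \<tau>: "\<bar>\<tau>\<bar> \<le> 1/2"
  shows "(\<integral>\<^sup>+y. ennreal (normal_density (center y) \<sigma> z * (1 + clip (tilt y * (z - center y) / \<sigma>\<^sup>2)))
      * indicator {\<tau> - 1/2..\<tau> + 1/2} y \<partial>lborel)
    \<le> ennreal (normal_density \<bar>\<tau>\<bar> \<sigma> z) + (\<integral>\<^sup>+y. ennreal (sqrt 2 * exp (- \<sigma>\<^sup>2 / 9)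
        * normal_density (center y) (sqrt 2 * \<sigma>) z) * indicator {\<tau> - 1/2..\<tau> + 1/2} y \<partial>lborel)"
proof -
  let ?I = "{\<tau> - 1/2..\<tau> + 1/2}"
  define c where "c y = normal_density (center y) \<sigma> z * (1 + clip (tilt y * (z - center y) / \<sigma>\<^sup>2))" for y
  define k where "k y = normal_density (center y) \<sigma> z * (1 + tilt y * (z - center y) / \<sigma>\<^sup>2)" for y
  define e where "e y = sqrt 2 * exp (- \<sigma>\<^sup>2 / 9) * normal_density (center y) (sqrt 2 * \<sigma>) z" for y
  have le: "c y \<le> k y + e y" if "y \<in> ?I" for y
    unfolding c_def k_def e_def using that \<tau> by (intro clip_error \<sigma> abs_tilt_le) auto
  have c0: "c y \<ge> 0" for y
    using clip_bounds(1)[of "tilt y * (z - center y) / \<sigma>\<^sup>2"] by (simp add: c_def)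
  have "continuous_on ?I e"
    unfolding e_def normal_density_def center_def using \<sigma>(2) by (intro continuous_intros) auto
  then have e: "(e has_integral integral ?I e) ?I"
    by (intro integrable_integral integrable_continuous_real)
  have k: "(k has_integral normal_density \<bar>\<tau>\<bar> \<sigma> z) ?I"
    unfolding k_def by (rule tilted_density_has_integral[OF \<sigma>(2) \<tau>])
  have "integral ?I e \<ge> 0"
    by (rule has_integral_nonneg[OF e]) (simp add: e_def)
  have "(\<integral>\<^sup>+y. ennreal (c y) * indicator ?I y \<partial>lborel) \<le> (\<integral>\<^sup>+y. ennreal (k y + e y) * indicator ?I y \<partial>lborel)"
    by (intro nn_integral_mono) (auto simp: le intro!: ennreal_leI split: split_indicator)
  \<comment> \<open>The function \<open>k\<close> may be negative, so converting it to
    \<open>ennreal\<close> alone would truncate it. The sum \<open>k + e\<close> dominates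
    \<open>c\<close>, hence is nonnegative, and can be evaluated as a real integral.\<close>
  also have "\<dots> = ennreal (normal_density \<bar>\<tau>\<bar> \<sigma> z + integral ?I e)"
    by (intro nn_integral_has_integral_lebesgue' has_integral_add k e order_trans[OF c0 le])
  also have "\<dots> = ennreal (normal_density \<bar>\<tau>\<bar> \<sigma> z) + ennreal (integral ?I e)"
    using \<open>integral ?I e \<ge> 0\<close> by simp
  also have "ennreal (integral ?I e) = (\<integral>\<^sup>+y. ennreal (e y) * indicator ?I y \<partial>lborel)"
    by (rule nn_integral_has_integral_lebesgue'[OF _ e, symmetric]) (simp add: e_def)
  finally show ?thesis unfolding c_def k_def e_def .
qed

section \<open>Drawing from the clipped kernel\<close>

text \<open>For \<open>u\<close> uniform on the unit interval the test \<open>2 * u < 1 + t\<close>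
  succeeds with probability \<open>(1 + clip t) / 2\<close>. The range of \<open>u\<close> thus does
  the clipping, and \<open>clip\<close> is never computed.\<close>

definition resample :: "real \<Rightarrow> real \<Rightarrow> real \<Rightarrow> real \<Rightarrow> real" where
  "resample \<sigma> y u w = (if 2 * u < 1 + tilt y * w / \<sigma> then center y + \<sigma> * w else center y - \<sigma> * w)"

lemma resample_measurable [measurable (raw)]:
  assumes [measurable]: "f \<in> borel_measurable M" "g \<in> borel_measurable M" "h \<in> borel_measurable M"
  shows "(\<lambda>x. resample \<sigma> (f x) (g x) (h x)) \<in> borel_measurable M"
  unfolding resample_def by measurable

lemma nn_integral_uniform_unit_interval:
  fixes f :: "real \<Rightarrow> ennreal"
  assumes "f \<in> borel_measurable borel" and "b = a + 1"
  shows "(\<integral>\<^sup>+u. f u \<partial>uniform_measure lborel {a..b}) = (\<integral>\<^sup>+u. f u * indicator {a..b} u \<partial>lborel)"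
  using assms by (subst nn_integral_uniform_measure) (auto simp: divide_ennreal_def)

lemma nn_integral_uniform_threshold:
  fixes a b :: ennreal
  shows "(\<integral>\<^sup>+u. (if 2 * u < 1 + t then a else b) \<partial>uniform_measure lborel {0..1})
    = ennreal ((1 + clip t) / 2) * a + ennreal ((1 - clip t) / 2) * b"
proof -
  define p where "p = (1 + clip t) / 2"
  have p: "0 \<le> p" "p \<le> 1" using clip_bounds[of t] by (auto simp: p_def)
  have "(\<integral>\<^sup>+u. (if 2 * u < 1 + t then a else b) \<partial>uniform_measure lborel {0..1})
      = (\<integral>\<^sup>+u. (if 2 * u < 1 + t then a else b) * indicator {0..1} u \<partial>lborel)"
    by (rule nn_integral_uniform_unit_interval) auto
  also have "\<dots> = (\<integral>\<^sup>+u. a * indicator {0..p} u + b * indicator {p<..1} u \<partial>lborel)"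
  proof (rule nn_integral_cong_AE)
    \<comment> \<open>The two sides can differ only at the threshold \<open>u = p\<close>.\<close>
    show "AE u in lborel. (if 2 * u < 1 + t then a else b) * indicator {0..1} u
        = a * indicator {0..p} u + b * indicator {p<..1} u"
      using AE_lborel_singleton[of p] AE_lborel_singleton[of 0] AE_lborel_singleton[of 1]
      by eventually_elim (auto simp: p_def clip_def max_def min_def split: split_indicator if_splits)
  qed
  also have "\<dots> = ennreal p * a + ennreal (1 - p) * b"
    using p by (subst nn_integral_add) (auto simp: nn_integral_cmult mult.commute)
  finally show ?thesis by (simp add: p_def field_simps)
qed

lemma sets_std_gaussian [simp, measurable_cong]: "sets std_gaussian = sets borel"
  by (simp add: std_gaussian_def)

lemma nn_integral_std_gaussian:
  fixes f :: "real \<Rightarrow> ennreal"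
  assumes "f \<in> borel_measurable borel"
  shows "(\<integral>\<^sup>+w. f w \<partial>std_gaussian) = (\<integral>\<^sup>+w. ennreal (normal_density 0 1 w) * f w \<partial>lborel)"
  using assms unfolding std_gaussian_def by (subst nn_integral_density) auto

lemma nn_integral_std_gaussian_affine:
  fixes f :: "real \<Rightarrow> ennreal"
  assumes [measurable]: "f \<in> borel_measurable borel" and "\<sigma> > 0"
  shows "(\<integral>\<^sup>+w. f (m + \<sigma> * w) \<partial>std_gaussian) = (\<integral>\<^sup>+z. ennreal (normal_density m \<sigma> z) * f z \<partial>lborel)"
proof -
  have "ennreal \<sigma> * ennreal (normal_density m \<sigma> (m + \<sigma> * w)) = ennreal (normal_density 0 1 w)" for w
    using assms(2)
    by (subst ennreal_mult[symmetric])
       (auto simp: normal_density_def real_sqrt_mult power_mult_distrib field_simps)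
  then show ?thesis
    using assms(2)
    by (subst nn_integral_real_affine[of _ \<sigma> m])
       (auto simp: nn_integral_std_gaussian simp flip: nn_integral_cmult mult.assoc)
qed

lemma nn_integral_std_gaussian_uminus:
  fixes f :: "real \<Rightarrow> ennreal"
  assumes [measurable]: "f \<in> borel_measurable borel"
  shows "(\<integral>\<^sup>+w. f (- w) \<partial>std_gaussian) = (\<integral>\<^sup>+w. f w \<partial>std_gaussian)"
  by (simp add: nn_integral_std_gaussian, subst nn_integral_real_affine[of _ "-1" 0])
     (auto simp: normal_density_def)

text \<open>The sign flip turns the weight \<open>1 + clip t\<close> at \<open>w\<close> into \<open>1 - clip t\<close> at \<open>- w\<close>.\<close>

lemma nn_integral_resample:
  fixes g :: "real \<Rightarrow> ennreal"
  assumes [measurable]: "g \<in> borel_measurable borel" and \<sigma>: "\<sigma> > 0"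
  shows "(\<integral>\<^sup>+w. \<integral>\<^sup>+u. g (resample \<sigma> y u w) \<partial>uniform_measure lborel {0..1} \<partial>std_gaussian)
    = (\<integral>\<^sup>+z. ennreal (normal_density (center y) \<sigma> z * (1 + clip (tilt y * (z - center y) / \<sigma>\<^sup>2)))
        * g z \<partial>lborel)"
proof -
  let ?c = "\<lambda>w. clip (tilt y * w / \<sigma>)" and ?m = "center y"
  have c: "0 \<le> 1 + ?c w" "0 \<le> 1 - ?c w" for w
    using clip_bounds[of "tilt y * w / \<sigma>"] by auto
  have "(\<integral>\<^sup>+u. g (resample \<sigma> y u w) \<partial>uniform_measure lborel {0..1})
      = ennreal ((1 + ?c w) / 2) * g (?m + \<sigma> * w) + ennreal ((1 - ?c w) / 2) * g (?m - \<sigma> * w)" for w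
    unfolding nn_integral_uniform_threshold[symmetric]
    by (intro nn_integral_cong) (simp add: resample_def)
  then have "(\<integral>\<^sup>+w. \<integral>\<^sup>+u. g (resample \<sigma> y u w) \<partial>uniform_measure lborel {0..1} \<partial>std_gaussian)
      = (\<integral>\<^sup>+w. ennreal ((1 + ?c w) / 2) * g (?m + \<sigma> * w) \<partial>std_gaussian)
        + (\<integral>\<^sup>+w. ennreal ((1 - ?c w) / 2) * g (?m - \<sigma> * w) \<partial>std_gaussian)"
    by (simp add: nn_integral_add)
  also have "(\<integral>\<^sup>+w. ennreal ((1 - ?c w) / 2) * g (?m - \<sigma> * w) \<partial>std_gaussian)
      = (\<integral>\<^sup>+w. ennreal ((1 + ?c w) / 2) * g (?m + \<sigma> * w) \<partial>std_gaussian)"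
    by (subst nn_integral_std_gaussian_uminus[symmetric]) (auto simp: clip_minus)
  also have "(\<integral>\<^sup>+w. ennreal ((1 + ?c w) / 2) * g (?m + \<sigma> * w) \<partial>std_gaussian)
      + (\<integral>\<^sup>+w. ennreal ((1 + ?c w) / 2) * g (?m + \<sigma> * w) \<partial>std_gaussian)
      = (\<integral>\<^sup>+w. ennreal (1 + ?c w) * g (?m + \<sigma> * w) \<partial>std_gaussian)"
    using c by (subst nn_integral_add[symmetric])
      (auto simp: distrib_right[symmetric] ennreal_plus[symmetric] simp del: ennreal_plus)
  \<comment> \<open>Writing \<open>z = center y + \<sigma> * w\<close> turns
    \<open>w / \<sigma>\<close> into \<open>(z - center y) / \<sigma>\<^sup>2\<close>, the form in
    which the tilt occurs in the derivative.\<close>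
  also have "\<dots> = (\<integral>\<^sup>+w. (\<lambda>z. ennreal (1 + clip (tilt y * (z - ?m) / \<sigma>\<^sup>2)) * g z) (?m + \<sigma> * w) \<partial>std_gaussian)"
    using \<sigma> by (simp add: power2_eq_square)
  also have "\<dots> = (\<integral>\<^sup>+z. ennreal (normal_density ?m \<sigma> z) * (ennreal (1 + clip (tilt y * (z - ?m) / \<sigma>\<^sup>2)) * g z) \<partial>lborel)"
    by (rule nn_integral_std_gaussian_affine) (use \<sigma> in auto)
  finally show ?thesis
    by (simp add: ennreal_mult' mult.assoc)
qed

lemma nn_integral_normal_density:
  "\<sigma> > 0 \<Longrightarrow> (\<integral>\<^sup>+z. ennreal (normal_density m \<sigma> z) \<partial>lborel) = 1"
  by (simp add: nn_integral_eq_integral)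

text \<open>After shifting the noise by \<open>\<tau>\<close>, Tonelli's theorem exposes the mixture
  over responses at each fixed \<open>z\<close>, where \<open>clipped_mixture_le\<close> applies.
  Test functions bounded by 1, rather than events, are what the coordinatewise replacement in a
  product requires.\<close>

lemma resample_approx:
  fixes g :: "real \<Rightarrow> ennreal"
  assumes [measurable]: "g \<in> borel_measurable borel" and g1: "\<And>z. g z \<le> 1"
    and \<sigma>: "\<sigma>\<^sup>2 \<ge> 9" "\<sigma> > 0" and \<tau>: "\<bar>\<tau>\<bar> \<le> 1/2"
  shows "(\<integral>\<^sup>+\<xi>. \<integral>\<^sup>+w. \<integral>\<^sup>+u. g (resample \<sigma> (\<tau> + \<xi>) u w)
        \<partial>uniform_measure lborel {0..1} \<partial>std_gaussian \<partial>uniform_measure lborel {-1/2..1/2})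
    \<le> (\<integral>\<^sup>+w. g (\<bar>\<tau>\<bar> + \<sigma> * w) \<partial>std_gaussian) + ennreal (sqrt 2 * exp (- \<sigma>\<^sup>2 / 9))"
proof -
  let ?I = "{\<tau> - 1/2..\<tau> + 1/2}"
  define c where "c y z = ennreal (normal_density (center y) \<sigma> z * (1 + clip (tilt y * (z - center y) / \<sigma>\<^sup>2)))" for y z
  define e where "e y z = ennreal (sqrt 2 * exp (- \<sigma>\<^sup>2 / 9) * normal_density (center y) (sqrt 2 * \<sigma>) z)" for y z
  have [measurable]: "case_prod c \<in> borel_measurable (borel \<Otimes>\<^sub>M borel)"
    "case_prod e \<in> borel_measurable (borel \<Otimes>\<^sub>M borel)"
    unfolding c_def e_def normal_density_def by measurable
  have "(\<integral>\<^sup>+\<xi>. \<integral>\<^sup>+w. \<integral>\<^sup>+u. g (resample \<sigma> (\<tau> + \<xi>) u w)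
        \<partial>uniform_measure lborel {0..1} \<partial>std_gaussian \<partial>uniform_measure lborel {-1/2..1/2})
      = (\<integral>\<^sup>+\<xi>. \<integral>\<^sup>+z. c (\<tau> + \<xi>) z * g z \<partial>lborel \<partial>uniform_measure lborel {-1/2..1/2})"
    using \<sigma>(2) by (simp add: nn_integral_resample c_def)
  also have "\<dots> = (\<integral>\<^sup>+\<xi>. (\<integral>\<^sup>+z. c (\<tau> + \<xi>) z * g z \<partial>lborel) * indicator {-1/2..1/2} \<xi> \<partial>lborel)"
    by (rule nn_integral_uniform_unit_interval) auto
  also have "\<dots> = (\<integral>\<^sup>+\<xi>. (\<lambda>y. (\<integral>\<^sup>+z. c y z * g z \<partial>lborel) * indicator ?I y) (\<tau> + 1 * \<xi>) \<partial>lborel)"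
    by (intro nn_integral_cong) (auto split: split_indicator)
  also have "\<dots> = (\<integral>\<^sup>+y. (\<integral>\<^sup>+z. c y z * g z \<partial>lborel) * indicator ?I y \<partial>lborel)"
    by (subst nn_integral_real_affine[of _ 1 \<tau>]) auto
  also have "\<dots> = (\<integral>\<^sup>+y. \<integral>\<^sup>+z. g z * (c y z * indicator ?I y) \<partial>lborel \<partial>lborel)"
    by (subst nn_integral_multc[symmetric]) (auto simp: mult_ac)
  also have "\<dots> = (\<integral>\<^sup>+z. g z * (\<integral>\<^sup>+y. c y z * indicator ?I y \<partial>lborel) \<partial>lborel)"
    by (subst lborel_pair.Fubini') (auto simp: nn_integral_cmult)
  also have "\<dots> \<le> (\<integral>\<^sup>+z. ennreal (normal_density \<bar>\<tau>\<bar> \<sigma> z) * g z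
      + (\<integral>\<^sup>+y. e y z * indicator ?I y \<partial>lborel) \<partial>lborel)"
  proof (rule nn_integral_mono)
    fix z
    have "g z * (\<integral>\<^sup>+y. c y z * indicator ?I y \<partial>lborel)
        \<le> g z * (ennreal (normal_density \<bar>\<tau>\<bar> \<sigma> z) + (\<integral>\<^sup>+y. e y z * indicator ?I y \<partial>lborel))"
      unfolding c_def e_def by (intro mult_left_mono clipped_mixture_le \<sigma> \<tau>) simp
    \<comment> \<open>The bound \<open>g z \<le> 1\<close> removes \<open>g\<close> from the error
      term, while the main term keeps it.\<close>
    also have "\<dots> \<le> ennreal (normal_density \<bar>\<tau>\<bar> \<sigma> z) * g z + 1 * (\<integral>\<^sup>+y. e y z * indicator ?I y \<partial>lborel)"
      unfolding distrib_left by (intro add_mono mult_right_mono g1) (simp_all add: mult.commute)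
    finally show "g z * (\<integral>\<^sup>+y. c y z * indicator ?I y \<partial>lborel) \<le> ennreal (normal_density \<bar>\<tau>\<bar> \<sigma> z) * g z
      + (\<integral>\<^sup>+y. e y z * indicator ?I y \<partial>lborel)" by simp
  qed
  also have "\<dots> = (\<integral>\<^sup>+w. g (\<bar>\<tau>\<bar> + \<sigma> * w) \<partial>std_gaussian)
      + (\<integral>\<^sup>+z. \<integral>\<^sup>+y. e y z * indicator ?I y \<partial>lborel \<partial>lborel)"
    using \<sigma>(2) by (simp add: nn_integral_add nn_integral_std_gaussian_affine)
  also have "(\<integral>\<^sup>+z. \<integral>\<^sup>+y. e y z * indicator ?I y \<partial>lborel \<partial>lborel)
      = (\<integral>\<^sup>+y. (\<integral>\<^sup>+z. e y z \<partial>lborel) * indicator ?I y \<partial>lborel)"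
    by (subst lborel_pair.Fubini') (auto simp: nn_integral_multc)
  \<comment> \<open>Each wide Gaussian has mass 1 in \<open>z\<close>, and the interval of responses
    has length 1, so the error mass is exactly the prefactor.\<close>
  also have "\<dots> = (\<integral>\<^sup>+y. ennreal (sqrt 2 * exp (- \<sigma>\<^sup>2 / 9)) * indicator ?I y \<partial>lborel)"
    using \<sigma>(2) by (simp add: e_def ennreal_mult nn_integral_cmult nn_integral_normal_density)
  also have "\<dots> = ennreal (sqrt 2 * exp (- \<sigma>\<^sup>2 / 9))"
    by (simp add: nn_integral_cmult_indicator)
  finally show ?thesis .
qed

section \<open>Product measures\<close>

lemma product_prob_spaceI: "(\<And>i. prob_space (M i)) \<Longrightarrow> product_prob_space M"
  unfolding product_prob_space_def product_prob_space_axioms_def product_sigma_finite_def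
  by (auto intro: prob_space_imp_sigma_finite)

text \<open>A hybrid argument: factors are replaced one at a time, each at its own cost. It is
  phrased for functions because averaging \<open>g\<close> over one coordinate leaves a function
  bounded by 1, not an indicator, to which the induction hypothesis is applied.\<close>

lemma nn_integral_PiM_approx:
  fixes g :: "('i \<Rightarrow> 'a) \<Rightarrow> ennreal" and \<epsilon> :: "'i \<Rightarrow> ennreal"
  assumes fin: "finite I"
    and M: "\<And>i. prob_space (M i)" and N: "\<And>i. prob_space (N i)"
    and sets_eq: "\<And>i. sets (M i) = sets (N i)"
    and approx: "\<And>i f. i \<in> I \<Longrightarrow> f \<in> borel_measurable (N i) \<Longrightarrow> (\<And>z. f z \<le> 1) \<Longrightarrow>
      (\<integral>\<^sup>+z. f z \<partial>M i) \<le> (\<integral>\<^sup>+z. f z \<partial>N i) + \<epsilon> i"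
    and g: "g \<in> borel_measurable (PiM I N)" "\<And>x. g x \<le> 1"
  shows "(\<integral>\<^sup>+x. g x \<partial>PiM I M) \<le> (\<integral>\<^sup>+x. g x \<partial>PiM I N) + (\<Sum>i\<in>I. \<epsilon> i)"
  using fin approx g
proof (induction I arbitrary: g)
  case empty
  then show ?case by (simp add: space_PiM PiM_empty nn_integral_count_space_finite)
next
  case (insert i I)
  interpret M: product_prob_space M I by (rule product_prob_spaceI) fact
  interpret N: product_prob_space N I by (rule product_prob_spaceI) fact
  note insert.prems(2)[measurable]
  have sets_PiM: "sets (PiM J M) = sets (PiM J N)" for J
    by (rule sets_PiM_cong) (auto simp: sets_eq)
  have g': "(\<lambda>y. g (x(i := y))) \<in> borel_measurable (N i)" if "x \<in> space (PiM I N)" for x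
    using that by measurable
  have G: "(\<lambda>x. \<integral>\<^sup>+y. g (x(i := y)) \<partial>N i) \<in> borel_measurable (PiM I N)"
    by (rule sigma_finite_measure.borel_measurable_nn_integral[OF prob_space_imp_sigma_finite[OF N]]) measurable
  have le1: "(\<integral>\<^sup>+y. g (x(i := y)) \<partial>N i) \<le> 1" for x
  proof -
    have "(\<integral>\<^sup>+y. g (x(i := y)) \<partial>N i) \<le> (\<integral>\<^sup>+y. 1 \<partial>N i)"
      by (intro nn_integral_mono insert.prems)
    then show ?thesis by (simp add: prob_space.emeasure_space_1[OF N])
  qed
  have "(\<integral>\<^sup>+x. g x \<partial>PiM (insert i I) M) = (\<integral>\<^sup>+x. \<integral>\<^sup>+y. g (x(i := y)) \<partial>M i \<partial>PiM I M)"
    using insert by (intro M.product_nn_integral_insert) (auto simp: measurable_cong_sets[OF sets_PiM refl])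
  also have "\<dots> \<le> (\<integral>\<^sup>+x. (\<integral>\<^sup>+y. g (x(i := y)) \<partial>N i) + \<epsilon> i \<partial>PiM I M)"
    using sets_eq_imp_space_eq[OF sets_PiM]
    by (intro nn_integral_mono insert.prems(1) g' insert.prems(3)) auto
  also have "\<dots> = (\<integral>\<^sup>+x. (\<integral>\<^sup>+y. g (x(i := y)) \<partial>N i) \<partial>PiM I M) + \<epsilon> i"
    using G by (subst nn_integral_add) (simp_all add: measurable_cong_sets[OF sets_PiM refl] M.emeasure_space_1)
  also have "\<dots> \<le> ((\<integral>\<^sup>+x. (\<integral>\<^sup>+y. g (x(i := y)) \<partial>N i) \<partial>PiM I N) + (\<Sum>i\<in>I. \<epsilon> i)) + \<epsilon> i"
    by (intro add_right_mono insert.IH insert.prems(1) le1 G) auto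
  also have "(\<integral>\<^sup>+x. (\<integral>\<^sup>+y. g (x(i := y)) \<partial>N i) \<partial>PiM I N) = (\<integral>\<^sup>+x. g x \<partial>PiM (insert i I) N)"
    using insert by (intro N.product_nn_integral_insert[symmetric]) auto
  finally show ?case using insert.hyps by (simp add: add_ac)
qed

section \<open>Coordinatewise images of product measures\<close>

lemma indicator_PiE_restrict:
  assumes "finite I"
  shows "indicator (Pi\<^sub>E I A) (\<lambda>i\<in>I. z i) = (\<Prod>i\<in>I. indicator (A i) (z i) :: ennreal)"
proof (cases "\<forall>i\<in>I. z i \<in> A i")
  case True
  then show ?thesis by (simp add: PiE_iff)
next
  case False
  then obtain i where "i \<in> I" "z i \<notin> A i" by blast
  then have "(\<Prod>i\<in>I. indicator (A i) (z i) :: ennreal) = 0"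
    using assms by (intro prod_zero bexI[of _ i]) auto
  with False show ?thesis by (auto simp: PiE_iff)
qed

text \<open>The index set \<open>J\<close> may be infinite, as for the tapes; the integrand reads
  only finitely many coordinates, so it factors through the marginal on \<open>I\<close>.\<close>

lemma nn_integral_PiM_prod_subset:
  fixes f :: "'i \<Rightarrow> 'a \<Rightarrow> ennreal"
  assumes "\<And>i. prob_space (M i)" "finite I" "I \<subseteq> J" and [measurable]: "\<And>i. f i \<in> borel_measurable (M i)"
  shows "(\<integral>\<^sup>+x. (\<Prod>i\<in>I. f i (x i)) \<partial>PiM J M) = (\<Prod>i\<in>I. \<integral>\<^sup>+y. f i y \<partial>M i)"
proof -
  interpret product_prob_space M J by (rule product_prob_spaceI) fact
  have "(\<Prod>i\<in>I. \<integral>\<^sup>+y. f i y \<partial>M i) = (\<integral>\<^sup>+x. (\<Prod>i\<in>I. f i (x i)) \<partial>PiM I M)"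
    using assms by (intro product_nn_integral_prod[symmetric]) auto
  also have "\<dots> = (\<integral>\<^sup>+x. (\<Prod>i\<in>I. f i (x i)) \<partial>distr (PiM J M) (PiM I M) (\<lambda>x. restrict x I))"
    using assms by (simp add: distr_PiM_restrict_finite)
  also have "\<dots> = (\<integral>\<^sup>+x. (\<Prod>i\<in>I. f i (restrict x I i)) \<partial>PiM J M)"
    using assms(3) by (intro nn_integral_distr measurable_restrict_subset) auto
  also have "\<dots> = (\<integral>\<^sup>+x. (\<Prod>i\<in>I. f i (x i)) \<partial>PiM J M)"
    by (intro nn_integral_cong prod.cong) auto
  finally show ?thesis by simp
qed

lemma distr_PiM_map:
  assumes M: "\<And>i. prob_space (M i)" and I: "finite I" "I \<subseteq> J"
    and f[measurable]: "\<And>i. f i \<in> M i \<rightarrow>\<^sub>M L i"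
  shows "distr (PiM J M) (PiM I L) (\<lambda>x. \<lambda>i\<in>I. f i (x i)) = PiM I (\<lambda>i. distr (M i) (L i) (f i))"
    (is "_ = PiM I ?D")
proof -
  interpret D: product_prob_space ?D I
    by (intro product_prob_spaceI prob_space.prob_space_distr M f)
  have T[measurable]: "(\<lambda>x. \<lambda>i\<in>I. f i (x i)) \<in> PiM J M \<rightarrow>\<^sub>M PiM I L"
    using I(2) by (intro measurable_restrict measurable_compose[OF _ f] measurable_component_singleton) auto
  show ?thesis
  proof (rule D.PiM_eqI)
    fix A assume "\<And>i. i \<in> I \<Longrightarrow> A i \<in> sets (?D i)"
    then have A: "\<And>i. i \<in> I \<Longrightarrow> A i \<in> sets (L i)" by simp
    \<comment> \<open>Outside \<open>I\<close> nothing is known about \<open>A\<close>; the empty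
      set there makes \<open>B i\<close> measurable for every index, as the factorization over
      \<open>I\<close> demands.\<close>
    define B where "B i = (if i \<in> I then A i else {})" for i
    have B[measurable]: "B i \<in> sets (L i)" for i using A by (simp add: B_def)
    have PiB: "Pi\<^sub>E I A = Pi\<^sub>E I B" by (auto simp: B_def PiE_iff)
    have "emeasure (distr (PiM J M) (PiM I L) (\<lambda>x. \<lambda>i\<in>I. f i (x i))) (Pi\<^sub>E I B)
        = (\<integral>\<^sup>+x. indicator (Pi\<^sub>E I B) (\<lambda>i\<in>I. f i (x i)) \<partial>PiM J M)"
      using I(1) by (subst nn_integral_indicator[symmetric], simp add: sets_PiM_I_finite, subst nn_integral_distr)
         (auto intro!: sets_PiM_I_finite)
    also have "\<dots> = (\<integral>\<^sup>+x. (\<Prod>i\<in>I. indicator (B i) (f i (x i))) \<partial>PiM J M)"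
      by (simp add: indicator_PiE_restrict I)
    also have "\<dots> = (\<Prod>i\<in>I. \<integral>\<^sup>+y. indicator (B i) (f i y) \<partial>M i)"
      by (rule nn_integral_PiM_prod_subset[OF M I]) measurable
    also have "\<dots> = (\<Prod>i\<in>I. emeasure (?D i) (B i))"
      by (intro prod.cong refl, subst nn_integral_indicator[symmetric], simp, subst nn_integral_distr) auto
    also have "\<dots> = (\<Prod>i\<in>I. emeasure (?D i) (A i))" by (simp add: B_def)
    finally show "emeasure (distr (PiM J M) (PiM I L) (\<lambda>x. \<lambda>i\<in>I. f i (x i))) (Pi\<^sub>E I A)
      = (\<Prod>i\<in>I. emeasure (?D i) (A i))" unfolding PiB .
  qed (auto intro!: sets_PiM_cong I)
qed

text \<open>Two independent product families may be paired coordinate by coordinate, which is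
  checked on boxes. This serves to combine the two tapes, and later to join the data noise to the
  internal draws.\<close>

lemma distr_pair_PiM_map:
  assumes M: "\<And>i. prob_space (M i)" and N: "\<And>i. prob_space (N i)"
    and I: "finite I" "I \<subseteq> J" "I \<subseteq> K"
    and f: "\<And>i. (\<lambda>(a, b). f i a b) \<in> M i \<Otimes>\<^sub>M N i \<rightarrow>\<^sub>M L i"
  shows "distr (PiM J M \<Otimes>\<^sub>M PiM K N) (PiM I L) (\<lambda>(a, b). \<lambda>i\<in>I. f i (a i) (b i))
    = PiM I (\<lambda>i. distr (M i \<Otimes>\<^sub>M N i) (L i) (\<lambda>(a, b). f i a b))"
    (is "distr _ _ ?T = PiM I ?D")
proof -
  interpret D: product_prob_space ?D I
    by (intro product_prob_spaceI prob_space.prob_space_distr prob_space_pair M N f)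
  interpret N: prob_space "PiM K N" by (intro prob_space_PiM N)
  interpret Ni: prob_space "N i" for i by fact
  have fi: "(\<lambda>x. f i (g x) (h x)) \<in> X \<rightarrow>\<^sub>M L i" if "g \<in> X \<rightarrow>\<^sub>M M i" "h \<in> X \<rightarrow>\<^sub>M N i" for i g h and X :: "'x measure"
    using measurable_compose[OF measurable_Pair[OF that] f] by simp
  note [measurable (raw)] = fi
  have T[measurable]: "?T \<in> PiM J M \<Otimes>\<^sub>M PiM K N \<rightarrow>\<^sub>M PiM I L"
    unfolding case_prod_beta using I
    by (intro measurable_restrict fi measurable_compose[OF measurable_fst measurable_component_singleton]
        measurable_compose[OF measurable_snd measurable_component_singleton]) auto
  show ?thesis
  proof (rule D.PiM_eqI)
    fix A assume "\<And>i. i \<in> I \<Longrightarrow> A i \<in> sets (?D i)"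
    then have A: "\<And>i. i \<in> I \<Longrightarrow> A i \<in> sets (L i)" by simp
    define B where "B i = (if i \<in> I then A i else {})" for i
    have B[measurable]: "B i \<in> sets (L i)" for i using A by (simp add: B_def)
    have PiB: "Pi\<^sub>E I A = Pi\<^sub>E I B" by (auto simp: B_def PiE_iff)
    have PiB_sets[measurable]: "Pi\<^sub>E I B \<in> sets (PiM I L)"
      using I(1) by (intro sets_PiM_I_finite B)
    have "emeasure (distr (PiM J M \<Otimes>\<^sub>M PiM K N) (PiM I L) ?T) (Pi\<^sub>E I B)
        = (\<integral>\<^sup>+p. indicator (Pi\<^sub>E I B) (?T p) \<partial>(PiM J M \<Otimes>\<^sub>M PiM K N))"
      by (subst nn_integral_indicator[symmetric], simp, subst nn_integral_distr) auto
    also have "\<dots> = (\<integral>\<^sup>+a. \<integral>\<^sup>+b. indicator (Pi\<^sub>E I B) (?T (a, b)) \<partial>PiM K N \<partial>PiM J M)"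
      by (rule N.nn_integral_fst[symmetric]) measurable
    also have "\<dots> = (\<integral>\<^sup>+a. \<integral>\<^sup>+b. (\<Prod>i\<in>I. indicator (B i) (f i (a i) (b i))) \<partial>PiM K N \<partial>PiM J M)"
      by (simp add: indicator_PiE_restrict I)
    also have "\<dots> = (\<integral>\<^sup>+a. (\<Prod>i\<in>I. \<integral>\<^sup>+y. indicator (B i) (f i (a i) y) \<partial>N i) \<partial>PiM J M)"
    proof (rule nn_integral_cong)
      fix a assume "a \<in> space (PiM J M)"
      \<comment> \<open>Off \<open>I\<close>, where \<open>a\<close> need not be defined, an
        arbitrary point of the space is inserted so that every section \<open>f i (c i)\<close> is
        measurable.\<close>
      define c where "c i = (if i \<in> I then a i else (SOME x. x \<in> space (M i)))" for i
      have c: "c i \<in> space (M i)" for i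
        using \<open>a \<in> space (PiM J M)\<close> I(2) prob_space.not_empty[OF M, of i]
        by (auto simp: c_def space_PiM some_in_eq)
      have "(\<integral>\<^sup>+b. (\<Prod>i\<in>I. indicator (B i) (f i (c i) (b i))) \<partial>PiM K N)
          = (\<Prod>i\<in>I. \<integral>\<^sup>+y. indicator (B i) (f i (c i) y) \<partial>N i)"
        using c by (intro nn_integral_PiM_prod_subset[OF N I(1,3)]) measurable
      then show "(\<integral>\<^sup>+b. (\<Prod>i\<in>I. indicator (B i) (f i (a i) (b i))) \<partial>PiM K N)
          = (\<Prod>i\<in>I. \<integral>\<^sup>+y. indicator (B i) (f i (a i) y) \<partial>N i)"
        by (simp add: c_def cong: prod.cong_simp)
    qed
    also have "\<dots> = (\<Prod>i\<in>I. \<integral>\<^sup>+x. \<integral>\<^sup>+y. indicator (B i) (f i x y) \<partial>N i \<partial>M i)"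
      by (rule nn_integral_PiM_prod_subset[OF M I(1,2)]) measurable
    also have "\<dots> = (\<Prod>i\<in>I. emeasure (?D i) (B i))"
    proof (intro prod.cong refl)
      fix i
      have "(\<integral>\<^sup>+x. \<integral>\<^sup>+y. indicator (B i) (f i x y) \<partial>N i \<partial>M i)
          = (\<integral>\<^sup>+p. indicator (B i) (case p of (a, b) \<Rightarrow> f i a b) \<partial>(M i \<Otimes>\<^sub>M N i))"
        by (subst Ni.nn_integral_fst[symmetric]) (auto intro!: measurable_compose[OF f])
      also have "\<dots> = emeasure (?D i) (B i)"
        by (subst nn_integral_indicator[symmetric], simp, subst nn_integral_distr) (auto intro: f)
      finally show "(\<integral>\<^sup>+x. \<integral>\<^sup>+y. indicator (B i) (f i x y) \<partial>N i \<partial>M i) = emeasure (?D i) (B i)" .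
    qed
    also have "\<dots> = (\<Prod>i\<in>I. emeasure (?D i) (A i))" by (simp add: B_def)
    finally show "emeasure (distr (PiM J M \<Otimes>\<^sub>M PiM K N) (PiM I L) ?T) (Pi\<^sub>E I A)
      = (\<Prod>i\<in>I. emeasure (?D i) (A i))" unfolding PiB .
  qed (auto intro!: sets_PiM_cong I)
qed

section \<open>The program\<close>

definition half_exp :: rexp where
  "half_exp = RDiv (RConst 1) (RConst 2)"

definition abs_exp :: "rexp \<Rightarrow> rexp" where
  "abs_exp a = RSqrt (RMul a a)"

text \<open>The convention \<open>x / 0 = 0\<close> makes this quotient agree with
  \<open>sgn\<close> at 0 as well.\<close>

definition sgn_exp :: "rexp \<Rightarrow> rexp" where
  "sgn_exp a = RDiv a (abs_exp a)"

definition center_exp :: "rexp \<Rightarrow> rexp" where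
  "center_exp a = abs_exp (RSub (abs_exp a) half_exp)"

definition tilt_exp :: "rexp \<Rightarrow> rexp" where
  "tilt_exp a = RMul (RAdd a half_exp) (RMul (sgn_exp (RSub (abs_exp a) half_exp)) (sgn_exp a))"

text \<open>Real cell 1 holds \<open>\<sigma>\<close>, register 2 the current index; cells 2 and 3 receive the draws.\<close>

definition resample_step :: com where
  "resample_step =
    Seq (DrawUniform (IConst 2))
    (Seq (DrawGaussian (IConst 3))
    (Seq (CopyCovariate (IReg 2) (IReg 2))
    (Seq (Cond (RLess (RMul (RConst 2) (RMem (IConst 2)))
            (RAdd (RConst 1) (RDiv (RMul (tilt_exp (Response (IReg 2))) (RMem (IConst 3))) (RMem (IConst 1)))))
          (WriteResponse (IReg 2) (RAdd (center_exp (Response (IReg 2))) (RMul (RMem (IConst 1)) (RMem (IConst 3)))))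
          (WriteResponse (IReg 2) (RSub (center_exp (Response (IReg 2))) (RMul (RMem (IConst 1)) (RMem (IConst 3))))))
      (SetReg 2 (IAdd (IReg 2) (IConst 1))))))"

definition resample_loop :: com where
  "resample_loop = Loop (ILess (IReg 2) (IReg 0)) resample_step"

definition resample_prog :: com where
  "resample_prog =
    Seq (SetMem (IConst 1) (RMul (RConst 3) (RSqrt (RLn
          (RDiv (RMul (RConst 20) (ROfNat (IReg 0))) (RMem (IConst 0)))))))
      resample_loop"

lemma rval_half_exp [simp]: "rval e s half_exp = 1/2"
  by (simp add: half_exp_def)

lemma rval_abs_exp [simp]: "rval e s (abs_exp a) = \<bar>rval e s a\<bar>"
  by (simp add: abs_exp_def)

lemma rval_sgn_exp [simp]: "rval e s (sgn_exp a) = sgn (rval e s a)"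
  by (simp add: sgn_exp_def sgn_if)

lemma rval_center_exp [simp]: "rval e s (center_exp a) = center (rval e s a)"
  by (simp add: center_exp_def center_def)

lemma rval_tilt_exp [simp]: "rval e s (tilt_exp a) = tilt (rval e s a)"
  by (simp add: tilt_exp_def tilt_def)

lemma rcost_center_exp [simp]: "rcost (center_exp a) = 14 + 4 * rcost a"
  by (simp add: center_exp_def abs_exp_def half_exp_def)

lemma rcost_tilt_exp [simp]: "rcost (tilt_exp a) = 30 + 10 * rcost a"
  by (simp add: tilt_exp_def sgn_exp_def abs_exp_def half_exp_def)

section \<open>Correctness and running time of the program\<close>

lemma exec_resample_step:
  defines "j \<equiv> \<lambda>s. regs s 2"
  assumes "memory s 1 = \<sigma>"
  shows "\<exists>t s'. exec e resample_step s t s' \<and> t \<le> 110 \<and>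
    regs s' = (regs s)(2 := Suc (j s)) \<and> memory s' 1 = \<sigma> \<and>
    unif_pos s' = Suc (unif_pos s) \<and> gauss_pos s' = Suc (gauss_pos s) \<and>
    out_x s' = (out_x s)(j s := in_x e (j s)) \<and>
    out_y s' = (out_y s)(j s :=
      resample \<sigma> (in_y e (j s)) (unif_tape e (unif_pos s)) (gauss_tape e (gauss_pos s)))"
proof (cases "2 * unif_tape e (unif_pos s) < 1 + tilt (in_y e (j s)) * gauss_tape e (gauss_pos s) / \<sigma>")
  case True
  show ?thesis unfolding resample_step_def
    apply (intro exI conjI)
    apply (rule exec.Seq[OF exec.DrawUniform exec.Seq[OF exec.DrawGaussian exec.Seq[OF exec.CopyCovariate
        exec.Seq[OF exec.CondTrue[OF _ exec.WriteResponse] exec.SetReg]]]])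
    using True assms
    by (simp_all add: resample_def)
next
  case False
  show ?thesis unfolding resample_step_def
    apply (intro exI conjI)
    apply (rule exec.Seq[OF exec.DrawUniform exec.Seq[OF exec.DrawGaussian exec.Seq[OF exec.CopyCovariate
        exec.Seq[OF exec.CondFalse[OF _ exec.WriteResponse] exec.SetReg]]]])
    using False assms
    by (simp_all add: resample_def)
qed

text \<open>Both tape positions equal the loop index, so response \<open>k\<close> consumes entry
  \<open>k\<close> of each tape. An iteration costs at most 110 for the body and 4 for its test; the
  last 4 pays for the failing test.\<close>

lemma exec_resample_loop:
  assumes "memory s 1 = \<sigma>" "regs s 0 = n" "regs s 2 = i" "unif_pos s = i" "gauss_pos s = i" "i \<le> n"
  shows "\<exists>t s'. exec e resample_loop s t s' \<and> t \<le> 114 * (n - i) + 4 \<and>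
    out_x s' = (\<lambda>k. if i \<le> k \<and> k < n then in_x e k else out_x s k) \<and>
    out_y s' = (\<lambda>k. if i \<le> k \<and> k < n then resample \<sigma> (in_y e k) (unif_tape e k) (gauss_tape e k)
      else out_y s k)"
  using assms
proof (induction "n - i" arbitrary: i s)
  case 0
  then have "\<not> bval e s (ILess (IReg 2) (IReg 0))" by simp
  from exec.LoopFalse[OF this, of resample_step] 0 show ?case
    unfolding resample_loop_def by (intro exI[of _ s] exI conjI) (auto simp: fun_eq_iff)
next
  case (Suc m)
  then have b: "bval e s (ILess (IReg 2) (IReg 0))" by simp
  obtain t1 s1 where 1: "exec e resample_step s t1 s1" "t1 \<le> 110"
    "regs s1 = (regs s)(2 := Suc i)" "memory s1 1 = \<sigma>"
    "unif_pos s1 = Suc i" "gauss_pos s1 = Suc i"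
    "out_x s1 = (out_x s)(i := in_x e i)"
    "out_y s1 = (out_y s)(i := resample \<sigma> (in_y e i) (unif_tape e i) (gauss_tape e i))"
    using exec_resample_step[OF Suc.prems(1), of e] Suc.prems by auto
  obtain t2 s2 where 2: "exec e resample_loop s1 t2 s2" "t2 \<le> 114 * (n - Suc i) + 4"
    "out_x s2 = (\<lambda>k. if Suc i \<le> k \<and> k < n then in_x e k else out_x s1 k)"
    "out_y s2 = (\<lambda>k. if Suc i \<le> k \<and> k < n then resample \<sigma> (in_y e k) (unif_tape e k) (gauss_tape e k)
      else out_y s1 k)"
  proof -
    have "m = n - Suc i" "Suc i \<le> n" "regs s1 0 = n" "regs s1 2 = Suc i"
      using Suc.hyps(2) Suc.prems(2) 1(3) by auto
    then show ?thesis using Suc.hyps(1)[of "Suc i" s1] 1(4-6) that by blast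
  qed
  have "exec e resample_loop s (1 + bcost (ILess (IReg 2) (IReg 0)) + t1 + t2) s2"
    unfolding resample_loop_def using b 1(1) 2(1)[unfolded resample_loop_def] by (rule exec.LoopTrue)
  moreover have "1 + bcost (ILess (IReg 2) (IReg 0)) + t1 + t2 \<le> 114 * (n - i) + 4"
    using 1(2) 2(2) Suc.hyps(2) by simp
  moreover have "out_x s2 = (\<lambda>k. if i \<le> k \<and> k < n then in_x e k else out_x s k)"
    "out_y s2 = (\<lambda>k. if i \<le> k \<and> k < n then resample \<sigma> (in_y e k) (unif_tape e k) (gauss_tape e k)
      else out_y s k)"
    using 1(7,8) 2(3,4) Suc.hyps(2) by (auto simp: fun_eq_iff Suc_le_eq le_less)
  ultimately show ?case by blast
qed

definition resample_data :: "nat \<Rightarrow> real \<Rightarrow> dataset \<Rightarrow> (nat \<Rightarrow> real) \<times> (nat \<Rightarrow> real) \<Rightarrow> dataset" where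
  "resample_data n \<sigma> D \<omega> = (\<lambda>i\<in>{..<n}. (fst (D i), resample \<sigma> (snd (D i)) (fst \<omega> i) (snd \<omega> i)))"

lemma exec_resample_prog:
  assumes D: "D \<in> space (data_space n d)"
  shows "\<exists>t s. exec (make_input n d D \<omega>) resample_prog (init_state n d \<delta>) t s \<and>
    t \<le> 114 * n + 20 \<and>
    final_output n d s = resample_data n (3 * sqrt (ln (20 * real n / \<delta>))) D \<omega>"
proof -
  let ?e = "make_input n d D \<omega>" and ?\<sigma> = "3 * sqrt (ln (20 * real n / \<delta>))"
  define s0 where "s0 = (init_state n d \<delta>)\<lparr>memory := (memory (init_state n d \<delta>))(1 := ?\<sigma>)\<rparr>"
  have s0: "memory s0 1 = ?\<sigma>" "regs s0 0 = n" "regs s0 2 = 0" "unif_pos s0 = 0" "gauss_pos s0 = 0" "0 \<le> n"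
    and out: "out_x s0 = (\<lambda>_ _. 0)" "out_y s0 = (\<lambda>_. 0)"
    by (simp_all add: s0_def init_state_def)
  let ?a = "RMul (RConst 3) (RSqrt (RLn (RDiv (RMul (RConst 20) (ROfNat (IReg 0))) (RMem (IConst 0)))))"
  have "s0 = (init_state n d \<delta>)\<lparr>memory := (memory (init_state n d \<delta>))
      (ival (init_state n d \<delta>) (IConst 1) := rval ?e (init_state n d \<delta>) ?a)\<rparr>"
    by (simp add: s0_def init_state_def)
  then have 1: "exec ?e (SetMem (IConst 1) ?a) (init_state n d \<delta>) (1 + icost (IConst 1) + rcost ?a) s0"
    by (simp only: exec.SetMem)
  obtain t s where 2: "exec ?e resample_loop s0 t s" "t \<le> 114 * n + 4"
    "out_x s = (\<lambda>k. if k < n then in_x ?e k else (\<lambda>_. 0))"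
    "out_y s = (\<lambda>k. if k < n then resample ?\<sigma> (in_y ?e k) (unif_tape ?e k) (gauss_tape ?e k) else 0)"
    using exec_resample_loop[OF s0, of ?e] unfolding out by auto
  \<comment> \<open>The program sees vectors padded by 0 beyond \<open>d\<close>, and
    \<open>final_output\<close> cuts them off again. Extensionality of the original vector makes the
    round trip an equality of functions.\<close>
  have "fst (D i) \<in> extensional {..<d}" if "i < n" for i
    using D that by (force simp: data_space_def Rd_def space_PiM space_pair_measure PiE_iff)
  then have "final_output n d s = resample_data n ?\<sigma> D \<omega>"
    by (auto simp: final_output_def resample_data_def 2 make_input_def fun_eq_iff extensional_def restrict_def)
  moreover have "1 + icost (IConst 1) + rcost ?a + t \<le> 114 * n + 20"
    using 2(2) by simp
  ultimately show ?thesis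
    using exec.Seq[OF 1 2(1)] unfolding resample_prog_def by blast
qed

section \<open>Total variation distance\<close>

text \<open>For probability measures an upper bound on all events yields the lower bound by passing
  to complements, so the one-sided estimates above suffice.\<close>

lemma tv_dist_leI:
  assumes "prob_space M" "prob_space N" and sets_eq: "sets M = sets N" and "e \<ge> 0"
    and le: "\<And>A. A \<in> sets M \<Longrightarrow> emeasure M A \<le> emeasure N A + ennreal e"
  shows "tv_dist M N \<le> e"
proof -
  interpret M: prob_space M by fact
  interpret N: prob_space N by fact
  have le': "measure M A \<le> measure N A + e" if "A \<in> sets M" for A
    using le[OF that] \<open>e \<ge> 0\<close>
    by (simp add: M.emeasure_eq_measure N.emeasure_eq_measure flip: ennreal_plus)
  have "\<bar>measure M A - measure N A\<bar> \<le> e" if "A \<in> sets M" for A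
  proof -
    have "measure M (space M - A) = 1 - measure M A" "measure N (space M - A) = 1 - measure N A"
      using that sets_eq sets_eq_imp_space_eq[OF sets_eq] M.prob_compl[of A] N.prob_compl[of A] by auto
    then show ?thesis
      using le'[OF that] le'[OF sets.compl_sets[OF that]] by linarith
  qed
  then show ?thesis
    unfolding tv_dist_def by (intro cSUP_least) auto
qed

section \<open>Laws of the tapes and of the resampled responses\<close>

abbreviation uniform_01 :: "real measure" where
  "uniform_01 \<equiv> uniform_measure lborel {0..1}"

abbreviation uniform_centered :: "real measure" where
  "uniform_centered \<equiv> uniform_measure lborel {-1/2..1/2}"

lemma prob_space_uniform_01: "prob_space uniform_01"
  by (rule prob_space_uniform_measure) auto

lemma prob_space_uniform_centered: "prob_space uniform_centered"
  by (rule prob_space_uniform_measure) auto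

lemma prob_space_std_gaussian: "prob_space std_gaussian"
  unfolding std_gaussian_def by (rule prob_space_normal_density) simp

lemmas prob_spaces = prob_space_uniform_01 prob_space_uniform_centered prob_space_std_gaussian

lemma prob_space_random_tapes: "prob_space random_tapes"
  unfolding random_tapes_def by (intro prob_space_pair prob_space_PiM prob_spaces)

lemma sets_random_tapes [measurable_cong]:
  "sets random_tapes = sets (PiM UNIV (\<lambda>_. borel) \<Otimes>\<^sub>M PiM UNIV (\<lambda>_. borel))"
  unfolding random_tapes_def by (intro sets_pair_measure_cong sets_PiM_cong) auto

lemma sets_PiM_uniform_centered [measurable_cong]:
  "sets (PiM I (\<lambda>_. uniform_centered)) = sets (PiM I (\<lambda>_. borel))"
  by (intro sets_PiM_cong) auto

lemma sets_PiM_std_gaussian [measurable_cong]: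
  "sets (PiM I (\<lambda>_. std_gaussian)) = sets (PiM I (\<lambda>_. borel))"
  by (intro sets_PiM_cong) auto

text \<open>Regrouping the finitely many entries that are read turns two infinite tapes into
  independent pairs of draws, one pair per response.\<close>

lemma distr_random_tapes:
  assumes "finite I"
  shows "distr random_tapes (PiM I (\<lambda>_. borel \<Otimes>\<^sub>M borel)) (\<lambda>\<omega>. \<lambda>i\<in>I. (fst \<omega> i, snd \<omega> i))
    = PiM I (\<lambda>_. uniform_01 \<Otimes>\<^sub>M std_gaussian)"
proof -
  have "sets (uniform_01 \<Otimes>\<^sub>M std_gaussian) = sets (borel \<Otimes>\<^sub>M borel)"
    by (intro sets_pair_measure_cong) auto
  then have "distr (uniform_01 \<Otimes>\<^sub>M std_gaussian) (borel \<Otimes>\<^sub>M borel) (\<lambda>(a, b). (a, b))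
      = uniform_01 \<Otimes>\<^sub>M std_gaussian"
    by (simp add: id_def distr_id2)
  moreover have "distr random_tapes (PiM I (\<lambda>_. borel \<Otimes>\<^sub>M borel)) (\<lambda>(a, b). \<lambda>i\<in>I. (a i, b i))
      = PiM I (\<lambda>_. distr (uniform_01 \<Otimes>\<^sub>M std_gaussian) (borel \<Otimes>\<^sub>M borel) (\<lambda>(a, b). (a, b)))"
    unfolding random_tapes_def using assms by (intro distr_pair_PiM_map prob_spaces) auto
  moreover have "(\<lambda>\<omega> :: (nat \<Rightarrow> real) \<times> (nat \<Rightarrow> real). \<lambda>i\<in>I. (fst \<omega> i, snd \<omega> i)) = (\<lambda>(a, b). \<lambda>i\<in>I. (a i, b i))"
    by (simp add: fun_eq_iff)
  ultimately show ?thesis by simp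
qed

definition resample_law :: "real \<Rightarrow> real \<Rightarrow> real measure" where
  "resample_law \<sigma> \<tau> = distr (uniform_centered \<Otimes>\<^sub>M (uniform_01 \<Otimes>\<^sub>M std_gaussian)) borel
    (\<lambda>(\<xi>, p). resample \<sigma> (\<tau> + \<xi>) (fst p) (snd p))"

lemma prob_space_resample_law: "prob_space (resample_law \<sigma> \<tau>)"
  unfolding resample_law_def
  by (intro prob_space.prob_space_distr prob_space_pair prob_spaces) measurable

lemma resample_law_approx:
  fixes g :: "real \<Rightarrow> ennreal"
  assumes [measurable]: "g \<in> borel_measurable borel" and "\<And>z. g z \<le> 1"
    and "\<sigma>\<^sup>2 \<ge> 9" "\<sigma> > 0" "\<bar>\<tau>\<bar> \<le> 1/2"
  shows "(\<integral>\<^sup>+z. g z \<partial>resample_law \<sigma> \<tau>)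
    \<le> (\<integral>\<^sup>+z. g z \<partial>distr std_gaussian borel (\<lambda>w. \<bar>\<tau>\<bar> + \<sigma> * w)) + ennreal (sqrt 2 * exp (- \<sigma>\<^sup>2 / 9))"
proof -
  interpret UG: prob_space "uniform_01 \<Otimes>\<^sub>M std_gaussian" by (intro prob_space_pair prob_spaces)
  interpret pair_sigma_finite uniform_01 std_gaussian
    by (intro pair_sigma_finite.intro prob_space_imp_sigma_finite prob_spaces)
  have "(\<integral>\<^sup>+z. g z \<partial>resample_law \<sigma> \<tau>)
      = (\<integral>\<^sup>+q. g (resample \<sigma> (\<tau> + fst q) (fst (snd q)) (snd (snd q)))
          \<partial>(uniform_centered \<Otimes>\<^sub>M (uniform_01 \<Otimes>\<^sub>M std_gaussian)))"
    unfolding resample_law_def by (subst nn_integral_distr) (auto simp: case_prod_beta)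
  also have "\<dots> = (\<integral>\<^sup>+\<xi>. \<integral>\<^sup>+p. g (resample \<sigma> (\<tau> + \<xi>) (fst p) (snd p))
      \<partial>(uniform_01 \<Otimes>\<^sub>M std_gaussian) \<partial>uniform_centered)"
    by (subst UG.nn_integral_fst[symmetric]) auto
  also have "\<dots> = (\<integral>\<^sup>+\<xi>. \<integral>\<^sup>+w. \<integral>\<^sup>+u. g (resample \<sigma> (\<tau> + \<xi>) u w) \<partial>uniform_01 \<partial>std_gaussian \<partial>uniform_centered)"
    by (intro nn_integral_cong, subst nn_integral_snd[symmetric]) auto
  also have "\<dots> \<le> (\<integral>\<^sup>+w. g (\<bar>\<tau>\<bar> + \<sigma> * w) \<partial>std_gaussian) + ennreal (sqrt 2 * exp (- \<sigma>\<^sup>2 / 9))"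
    using assms by (intro resample_approx)
  also have "(\<integral>\<^sup>+w. g (\<bar>\<tau>\<bar> + \<sigma> * w) \<partial>std_gaussian)
      = (\<integral>\<^sup>+z. g z \<partial>distr std_gaussian borel (\<lambda>w. \<bar>\<tau>\<bar> + \<sigma> * w))"
    by (subst nn_integral_distr) auto
  finally show ?thesis .
qed

text \<open>Response \<open>i\<close> depends only on its own noise and its own pair of draws.
  Grouping the randomness by index therefore makes the outputs independent, with the one-coordinate
  laws as factors.\<close>

lemma nn_integral_resample_tapes:
  fixes g :: "(nat \<Rightarrow> real) \<Rightarrow> ennreal"
  assumes I: "finite I" and g[measurable]: "g \<in> borel_measurable (PiM I (\<lambda>_. borel))"
  shows "(\<integral>\<^sup>+\<xi>. \<integral>\<^sup>+\<omega>. g (\<lambda>i\<in>I. resample \<sigma> (\<tau> i + \<xi> i) (fst \<omega> i) (snd \<omega> i))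
      \<partial>random_tapes \<partial>PiM I (\<lambda>_. uniform_centered))
    = (\<integral>\<^sup>+z. g z \<partial>PiM I (\<lambda>i. resample_law \<sigma> (\<tau> i)))"
proof -
  let ?UG = "\<lambda>_::nat. uniform_01 \<Otimes>\<^sub>M std_gaussian"
  let ?T = "\<lambda>(\<xi>, p). \<lambda>i\<in>I. resample \<sigma> (\<tau> i + \<xi> i) (fst (p i)) (snd (p i))"
  interpret UG: prob_space "PiM I ?UG" by (intro prob_space_PiM prob_space_pair prob_spaces)
  have UG[measurable_cong]: "sets (PiM I ?UG) = sets (PiM I (\<lambda>_. borel \<Otimes>\<^sub>M borel))"
    by (intro sets_PiM_cong sets_pair_measure_cong) auto
  have T[measurable]: "?T \<in> PiM I (\<lambda>_. uniform_centered) \<Otimes>\<^sub>M PiM I ?UG \<rightarrow>\<^sub>M PiM I (\<lambda>_. borel)"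
    unfolding case_prod_beta by measurable
  have "(\<integral>\<^sup>+\<omega>. g (\<lambda>i\<in>I. resample \<sigma> (\<tau> i + \<xi> i) (fst \<omega> i) (snd \<omega> i)) \<partial>random_tapes)
      = (\<integral>\<^sup>+p. g (?T (\<xi>, p)) \<partial>PiM I ?UG)" if "\<xi> \<in> space (PiM I (\<lambda>_. uniform_centered))" for \<xi>
  proof -
    have [measurable]: "(\<lambda>p. g (?T (\<xi>, p))) \<in> borel_measurable (PiM I (\<lambda>_. borel \<Otimes>\<^sub>M borel))"
      using measurable_compose[OF measurable_compose[OF measurable_Pair1'[OF that] T] g]
      by (simp cong: measurable_cong_sets add: UG)
    show ?thesis
      by (subst distr_random_tapes[OF I, symmetric], subst nn_integral_distr)
         (auto intro!: nn_integral_cong arg_cong[of _ _ g])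
  qed
  then have "(\<integral>\<^sup>+\<xi>. \<integral>\<^sup>+\<omega>. g (\<lambda>i\<in>I. resample \<sigma> (\<tau> i + \<xi> i) (fst \<omega> i) (snd \<omega> i))
      \<partial>random_tapes \<partial>PiM I (\<lambda>_. uniform_centered))
      = (\<integral>\<^sup>+\<xi>. \<integral>\<^sup>+p. g (?T (\<xi>, p)) \<partial>PiM I ?UG \<partial>PiM I (\<lambda>_. uniform_centered))"
    by (rule nn_integral_cong)
  also have "\<dots> = (\<integral>\<^sup>+q. g (?T q) \<partial>(PiM I (\<lambda>_. uniform_centered) \<Otimes>\<^sub>M PiM I ?UG))"
    by (rule UG.nn_integral_fst) measurable
  also have "\<dots> = (\<integral>\<^sup>+z. g z \<partial>distr (PiM I (\<lambda>_. uniform_centered) \<Otimes>\<^sub>M PiM I ?UG) (PiM I (\<lambda>_. borel)) ?T)"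
    by (rule nn_integral_distr[symmetric]) measurable
  also have "distr (PiM I (\<lambda>_. uniform_centered) \<Otimes>\<^sub>M PiM I ?UG) (PiM I (\<lambda>_. borel)) ?T
      = PiM I (\<lambda>i. resample_law \<sigma> (\<tau> i))"
    unfolding resample_law_def using I
    by (intro distr_pair_PiM_map prob_space_pair prob_spaces) auto
  finally show ?thesis .
qed

section \<open>The kernel and its total variation error\<close>

lemma resample_data_measurable:
  "(\<lambda>(D, \<omega>). resample_data n \<sigma> D \<omega>) \<in> data_space n d \<Otimes>\<^sub>M random_tapes \<rightarrow>\<^sub>M data_space n d"
  unfolding resample_data_def data_space_def case_prod_beta by measurable

definition resample_kernel :: "nat \<Rightarrow> nat \<Rightarrow> real \<Rightarrow> dataset \<Rightarrow> dataset measure" where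
  "resample_kernel n d \<sigma> D = distr random_tapes (data_space n d) (resample_data n \<sigma> D)"

lemma resample_kernel_measurable:
  "resample_kernel n d \<sigma> \<in> data_space n d \<rightarrow>\<^sub>M prob_algebra (data_space n d)"
  unfolding resample_kernel_def[abs_def]
  by (rule measurable_distr_prob_space2[OF measurable_const resample_data_measurable])
     (simp add: space_prob_algebra prob_space_random_tapes)

text \<open>The covariates are fixed and copied unchanged, so both laws are images of product laws
  of the responses under one map. The product bound then charges the one-response error
  \<open>n\<close> times.\<close>

lemma tv_dist_resample_kernel:
  assumes \<sigma>: "\<sigma>\<^sup>2 \<ge> 9" "\<sigma> > 0"
    and R: "\<And>i. i < n \<Longrightarrow> R i \<in> {-1, 1}"
    and x: "\<And>i. i < n \<Longrightarrow> x i \<in> space (Rd d)"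
    and small: "\<And>i. i < n \<Longrightarrow> \<bar>dotp d (x i) \<beta>\<bar> \<le> 1/2"
  shows "tv_dist (signed_model n d R \<beta> x \<bind> resample_kernel n d \<sigma>) (abs_model n d \<sigma> \<beta> x)
    \<le> real n * (sqrt 2 * exp (- \<sigma>\<^sup>2 / 9))"
proof -
  let ?I = "{..<n}" and ?D = "data_space n d" and ?h = "resample_kernel n d \<sigma>"
  let ?M = "signed_model n d R \<beta> x" and ?N = "abs_model n d \<sigma> \<beta> x"
  define \<tau> where "\<tau> i = R i * dotp d (x i) \<beta>" for i
  define e where "e = sqrt 2 * exp (- \<sigma>\<^sup>2 / 9)"
  \<comment> \<open>This map reattaches the fixed covariates; composing an event with it gives a
    test function of the responses alone.\<close>
  define \<Phi> where "\<Phi> z = (\<lambda>i\<in>?I. (x i, z i))" for z :: "nat \<Rightarrow> real"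
  let ?\<nu> = "\<lambda>i. distr std_gaussian borel (\<lambda>w. \<bar>\<tau> i\<bar> + \<sigma> * w)"
  \<comment> \<open>Here the unknown signs disappear: the target depends on \<open>\<tau> i\<close>
    only through its absolute value.\<close>
  have abs_\<tau>: "\<bar>\<tau> i\<bar> = \<bar>dotp d (x i) \<beta>\<bar>" if "i < n" for i
    using R[OF that] by (auto simp: \<tau>_def abs_mult)
  have \<Phi>[measurable]: "\<Phi> \<in> PiM ?I (\<lambda>_. borel) \<rightarrow>\<^sub>M ?D"
    unfolding \<Phi>_def data_space_def using x by (intro measurable_restrict measurable_Pair) auto
  have signed[measurable]: "(\<lambda>\<xi>. \<lambda>i\<in>?I. (x i, R i * dotp d (x i) \<beta> + \<xi> i))
      \<in> PiM ?I (\<lambda>_. uniform_centered) \<rightarrow>\<^sub>M ?D"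
    unfolding data_space_def using x by (intro measurable_restrict measurable_Pair) auto
  have abs[measurable]: "(\<lambda>\<epsilon>. \<lambda>i\<in>?I. (x i, \<bar>dotp d (x i) \<beta>\<bar> + \<sigma> * \<epsilon> i))
      \<in> PiM ?I (\<lambda>_. std_gaussian) \<rightarrow>\<^sub>M ?D"
    unfolding data_space_def using x by (intro measurable_restrict measurable_Pair) auto
  have M: "?M \<in> space (prob_algebra ?D)"
    using prob_space.prob_space_distr[OF prob_space_PiM signed] prob_spaces
    by (simp add: signed_model_def space_prob_algebra)
  have N: "prob_space ?N"
    unfolding abs_model_def by (intro prob_space.prob_space_distr[OF prob_space_PiM abs] prob_spaces)
  have bind: "?M \<bind> ?h \<in> space (prob_algebra ?D)"
    using measurable_space[OF measurable_bind_prob_space[OF measurable_const[OF M, of "count_space UNIV"]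
        resample_kernel_measurable]] by simp
  show ?thesis
    unfolding e_def[symmetric]
  proof (rule tv_dist_leI)
    show "prob_space (?M \<bind> ?h)" using bind by (simp add: space_prob_algebra)
    show "sets (?M \<bind> ?h) = sets ?N" using bind by (simp add: space_prob_algebra abs_model_def)
    show "prob_space ?N" by (rule N)
    show "0 \<le> real n * e" by (simp add: e_def)
    fix A assume "A \<in> sets (?M \<bind> ?h)"
    then have A[measurable]: "A \<in> sets ?D" using bind by (simp add: space_prob_algebra)
    have h_meas: "(\<lambda>D. emeasure (?h D) A) \<in> borel_measurable ?D"
      using measurable_emeasure_subprob_algebra[OF A] measurable_prob_algebraD[OF resample_kernel_measurable]
      by (rule measurable_compose[rotated])
    have "emeasure (?M \<bind> ?h) A = (\<integral>\<^sup>+D. emeasure (?h D) A \<partial>?M)"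
      by (rule emeasure_bind_prob_algebra[OF M resample_kernel_measurable A])
    also have "\<dots> = (\<integral>\<^sup>+\<xi>. emeasure (?h (\<lambda>i\<in>?I. (x i, R i * dotp d (x i) \<beta> + \<xi> i))) A
        \<partial>PiM ?I (\<lambda>_. uniform_centered))"
      unfolding signed_model_def by (rule nn_integral_distr[OF signed]) (simp add: h_meas)
    also have "\<dots> = (\<integral>\<^sup>+\<xi>. \<integral>\<^sup>+\<omega>. indicator A
          (\<Phi> (\<lambda>i\<in>?I. resample \<sigma> (\<tau> i + \<xi> i) (fst \<omega> i) (snd \<omega> i)))
        \<partial>random_tapes \<partial>PiM ?I (\<lambda>_. uniform_centered))"
    proof (rule nn_integral_cong)
      fix \<xi> assume \<xi>: "\<xi> \<in> space (PiM ?I (\<lambda>_. uniform_centered))"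
      let ?d = "\<lambda>i\<in>?I. (x i, R i * dotp d (x i) \<beta> + \<xi> i)"
      have [measurable]: "resample_data n \<sigma> ?d \<in> random_tapes \<rightarrow>\<^sub>M ?D"
        using measurable_compose[OF measurable_Pair1'[OF measurable_space[OF signed \<xi>]] resample_data_measurable]
        by simp
      have "emeasure (?h ?d) A = (\<integral>\<^sup>+\<omega>. indicator A (resample_data n \<sigma> ?d \<omega>) \<partial>random_tapes)"
        unfolding resample_kernel_def
        by (subst nn_integral_indicator[symmetric], simp, subst nn_integral_distr) auto
      also have "\<dots> = (\<integral>\<^sup>+\<omega>. indicator A
          (\<Phi> (\<lambda>i\<in>?I. resample \<sigma> (\<tau> i + \<xi> i) (fst \<omega> i) (snd \<omega> i))) \<partial>random_tapes)"
        by (intro nn_integral_cong arg_cong[of _ _ "indicator A"])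
           (auto simp: resample_data_def \<Phi>_def \<tau>_def)
      finally show "emeasure (?h ?d) A = \<dots>" .
    qed
    also have "\<dots> = (\<integral>\<^sup>+z. indicator A (\<Phi> z) \<partial>PiM ?I (\<lambda>i. resample_law \<sigma> (\<tau> i)))"
      by (rule nn_integral_resample_tapes) measurable
    also have "\<dots> \<le> (\<integral>\<^sup>+z. indicator A (\<Phi> z) \<partial>PiM ?I ?\<nu>) + (\<Sum>i\<in>?I. ennreal e)"
    proof (rule nn_integral_PiM_approx)
      show "prob_space (?\<nu> i)" for i
        by (intro prob_space.prob_space_distr prob_spaces) measurable
      show "sets (resample_law \<sigma> (\<tau> i)) = sets (?\<nu> i)" for i
        by (simp add: resample_law_def)
      show "(\<lambda>z. indicator A (\<Phi> z)) \<in> borel_measurable (PiM ?I ?\<nu>)"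
        by (subst measurable_cong_sets[OF sets_PiM_cong refl]) auto
    next
      fix i :: nat and f :: "real \<Rightarrow> ennreal"
      assume "i \<in> ?I" "f \<in> borel_measurable (?\<nu> i)" and f1: "f z \<le> 1" for z
      then show "(\<integral>\<^sup>+z. f z \<partial>resample_law \<sigma> (\<tau> i)) \<le> (\<integral>\<^sup>+z. f z \<partial>?\<nu> i) + ennreal e"
        unfolding e_def using small abs_\<tau> by (intro resample_law_approx \<sigma>) auto
    qed (auto simp: prob_space_resample_law indicator_def)
    also have "PiM ?I ?\<nu> = distr (PiM ?I (\<lambda>_. std_gaussian)) (PiM ?I (\<lambda>_. borel)) (\<lambda>\<epsilon>. \<lambda>i\<in>?I. \<bar>\<tau> i\<bar> + \<sigma> * \<epsilon> i)"
      by (intro distr_PiM_map[symmetric] prob_spaces) auto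
    also have "(\<integral>\<^sup>+z. indicator A (\<Phi> z) \<partial>distr (PiM ?I (\<lambda>_. std_gaussian)) (PiM ?I (\<lambda>_. borel)) (\<lambda>\<epsilon>. \<lambda>i\<in>?I. \<bar>\<tau> i\<bar> + \<sigma> * \<epsilon> i))
        = (\<integral>\<^sup>+\<epsilon>. indicator A (\<Phi> (\<lambda>i\<in>?I. \<bar>\<tau> i\<bar> + \<sigma> * \<epsilon> i)) \<partial>PiM ?I (\<lambda>_. std_gaussian))"
      by (rule nn_integral_distr) measurable
    also have "\<dots> = (\<integral>\<^sup>+\<epsilon>. indicator A (\<lambda>i\<in>?I. (x i, \<bar>dotp d (x i) \<beta>\<bar> + \<sigma> * \<epsilon> i)) \<partial>PiM ?I (\<lambda>_. std_gaussian))"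
      by (intro nn_integral_cong arg_cong[of _ _ "indicator A"]) (auto simp: \<Phi>_def abs_\<tau>)
    also have "\<dots> = emeasure ?N A"
      unfolding abs_model_def
      by (subst nn_integral_indicator[symmetric], simp, subst nn_integral_distr) auto
    also have "(\<Sum>i\<in>?I. ennreal e) = ennreal (real n * e)"
      by (simp add: e_def ennreal_mult ennreal_of_nat_eq_real_of_nat)
    finally show "emeasure (?M \<bind> ?h) A \<le> emeasure ?N A + ennreal (real n * e)" .
  qed
qed

text \<open>The exact bound \<open>114 * n + 20\<close> is linear, and \<open>134 = 114 + 20\<close>
  fits it into the required form with exponent 1, as \<open>ln (1 / \<delta>)\<close> is
  nonnegative.\<close>

lemma resample_prog_computes_kernel:
  assumes "n \<ge> 1" "0 < \<delta>" "\<delta> < 1"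
  shows "computes_kernel resample_prog n d \<delta> (real 134 * (1 + real n + ln (1 / \<delta>)) ^ 1)
    (resample_kernel n d (3 * sqrt (ln (20 * real n / \<delta>))))"
proof -
  have "ln (1 / \<delta>) \<ge> 0" using assms by simp
  then have time: "real t \<le> real 134 * (1 + real n + ln (1 / \<delta>)) ^ 1" if "t \<le> 114 * n + 20" for t
    using of_nat_mono[OF that, where 'a = real] by (simp add: algebra_simps)
  show ?thesis
    unfolding computes_kernel_def
  proof (intro exI[of _ "resample_data n (3 * sqrt (ln (20 * real n / \<delta>)))"] ballI conjI)
    fix D \<omega> assume D: "D \<in> space (data_space n d)"
    obtain t s where "exec (make_input n d D \<omega>) resample_prog (init_state n d \<delta>) t s" "t \<le> 114 * n + 20"
      "final_output n d s = resample_data n (3 * sqrt (ln (20 * real n / \<delta>))) D \<omega>"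
      using exec_resample_prog[OF D] by blast
    with time show "\<exists>t s. exec (make_input n d D \<omega>) resample_prog (init_state n d \<delta>) t s \<and>
        real t \<le> real 134 * (1 + real n + ln (1 / \<delta>)) ^ 1 \<and>
        final_output n d s = resample_data n (3 * sqrt (ln (20 * real n / \<delta>))) D \<omega>"
      by blast
  next
    fix D assume D: "D \<in> space (data_space n d)"
    show "resample_data n (3 * sqrt (ln (20 * real n / \<delta>))) D \<in> random_tapes \<rightarrow>\<^sub>M data_space n d"
      using measurable_compose[OF measurable_Pair1'[OF D] resample_data_measurable] by simp
  qed (simp add: resample_kernel_def)
qed

theorem corollary1:
  shows "\<exists>C::real. C > 0 \<and>
    (\<exists>(P::com) (K::nat) (k::nat).
      \<forall>(n::nat) (d::nat) (\<delta>::real) (\<sigma>::real).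
        n \<ge> 1 \<longrightarrow> d \<ge> 1 \<longrightarrow> 0 < \<delta> \<longrightarrow> \<delta> < 1 \<longrightarrow>
        \<sigma> = C * sqrt (ln (20 * real n / \<delta>)) \<longrightarrow>
        (\<exists>h. h \<in> data_space n d \<rightarrow>\<^sub>M prob_algebra (data_space n d) \<and>
          computes_kernel P n d \<delta> (real K * (1 + real n + ln (1 / \<delta>)) ^ k) h \<and>
          (\<forall>(R::nat \<Rightarrow> real) (\<beta>::vec) (x::nat \<Rightarrow> vec).
            (\<forall>i<n. R i \<in> {-1, 1}) \<longrightarrow>
            \<beta> \<in> space (Rd d) \<longrightarrow>
            (\<forall>i<n. x i \<in> space (Rd d)) \<longrightarrow>
            (\<forall>i<n. \<bar>dotp d (x i) \<beta>\<bar> \<le> 1/2) \<longrightarrow>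
            tv_dist (signed_model n d R \<beta> x \<bind> h) (abs_model n d \<sigma> \<beta> x) \<le> \<delta>)))"
proof (intro exI conjI allI impI)
  \<comment> \<open>The existential witnesses stay schematic until they are matched below:
    \<open>C = 3\<close>, the program \<open>resample_prog\<close>, \<open>K = 134\<close> and
    \<open>k = 1\<close>, all chosen before \<open>n\<close>, \<open>d\<close> and
    \<open>\<delta>\<close>.\<close>
  fix n d :: nat and \<delta> \<sigma> :: real
  assume n: "n \<ge> 1" and \<delta>: "0 < \<delta>" "\<delta> < 1" and \<sigma>_def: "\<sigma> = 3 * sqrt (ln (20 * real n / \<delta>))"
  define L where "L = ln (20 * real n / \<delta>)"
  \<comment> \<open>This gives \<open>L \<ge> 1\<close>, so that
    \<open>\<sigma>\<^sup>2 = 9 * L\<close> meets the hypothesis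
    \<open>\<sigma>\<^sup>2 \<ge> 9\<close> of the clipping bound.\<close>
  have "exp 1 \<le> 20 * real n / \<delta>"
  proof -
    have "exp 1 \<le> (3::real)" by (rule exp_le)
    also have "3 \<le> 20 * real n / \<delta>" using n \<delta> by (simp add: field_simps)
    finally show ?thesis .
  qed
  then have L: "L \<ge> 1"
    using n \<delta> unfolding L_def by (subst ln_ge_iff) auto
  have \<sigma>2: "\<sigma>\<^sup>2 = 9 * L" using L by (simp add: \<sigma>_def L_def power_mult_distrib)
  have \<sigma>: "\<sigma>\<^sup>2 \<ge> 9" "\<sigma> > 0" using L by (simp_all add: \<sigma>2) (simp add: \<sigma>_def L_def)
  \<comment> \<open>The choice \<open>C = 3\<close> cancels the 9 in the exponent. Each response
    then contributes \<open>sqrt 2 * \<delta> / (20 * n)\<close>, and the crude bound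
    \<open>sqrt 2 \<le> 20\<close> brings the total below \<open>\<delta>\<close>.\<close>
  have "exp (- \<sigma>\<^sup>2 / 9) = \<delta> / (20 * real n)"
    using n \<delta> by (simp add: \<sigma>2 exp_minus L_def)
  then have "real n * (20 * exp (- \<sigma>\<^sup>2 / 9)) = \<delta>"
    using n by simp
  moreover have "sqrt 2 \<le> 20" by (rule real_le_lsqrt) auto
  then have "real n * (sqrt 2 * exp (- \<sigma>\<^sup>2 / 9)) \<le> real n * (20 * exp (- \<sigma>\<^sup>2 / 9))"
    by (intro mult_left_mono mult_right_mono) auto
  ultimately have err: "real n * (sqrt 2 * exp (- \<sigma>\<^sup>2 / 9)) \<le> \<delta>"
    by simp
  show "resample_kernel n d \<sigma> \<in> data_space n d \<rightarrow>\<^sub>M prob_algebra (data_space n d)"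
    by (rule resample_kernel_measurable)
  show "computes_kernel resample_prog n d \<delta> (real 134 * (1 + real n + ln (1 / \<delta>)) ^ 1) (resample_kernel n d \<sigma>)"
    unfolding \<sigma>_def using n \<delta> by (rule resample_prog_computes_kernel)
  fix R :: "nat \<Rightarrow> real" and \<beta> :: vec and x :: "nat \<Rightarrow> vec"
  assume "\<forall>i<n. R i \<in> {-1, 1}" "\<forall>i<n. x i \<in> space (Rd d)" "\<forall>i<n. \<bar>dotp d (x i) \<beta>\<bar> \<le> 1/2"
  then have "tv_dist (signed_model n d R \<beta> x \<bind> resample_kernel n d \<sigma>) (abs_model n d \<sigma> \<beta> x)
      \<le> real n * (sqrt 2 * exp (- \<sigma>\<^sup>2 / 9))"
    by (intro tv_dist_resample_kernel \<sigma>) blast+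
  with err show "tv_dist (signed_model n d R \<beta> x \<bind> resample_kernel n d \<sigma>) (abs_model n d \<sigma> \<beta> x) \<le> \<delta>"
    by simp
qed simp

end
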